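(* For every integer $m\ge 2$, $$\pi_f(K_{1,m,m})=\frac{24m}{8m+5+3/(2\lceil m/2\rceil-1)}.$$
   Context: $K_{1,m,m}$ is the complete tripartite graph with parts of sizes $1,m,m$. Two edges are nonincident if they share no endpoint. A linear ordering of $V(G)$ separates a pair of nonincident edges if both endpoints of one edge precede both endpoints of the other. $\pi_t(G)$ is the minimum length of a list of linear orderings of $V(G)$ (repetitions allowed) separating every pair of nonincident edges at least $t$ times, and the fractional separation dimension is $\pi_f(G)=\liminf_{t\to\infty}\pi_t(G)/t$. *)

theory Defs
  imports "HOL-Analysis.Analysis"
begin

text \<open>A simple graph is given by its vertex set \<open>V\<close> and its set \<open>E\<close> of two-element
  subsets of \<open>V\<close>.\<close>

definition nonincident :: "'a set \<Rightarrow> 'a set \<Rightarrow> bool" where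
  "nonincident e f \<longleftrightarrow> e \<inter> f = {}"

text \<open>Linear orderings are reflexive, as in \<^const>\<open>linear_order_on\<close>. Since \<open>separates\<close> is only
  applied to disjoint edges, \<open>(x, y) \<in> r\<close> below means that \<open>x\<close> strictly precedes \<open>y\<close>.\<close>

definition separates :: "'a rel \<Rightarrow> 'a set \<Rightarrow> 'a set \<Rightarrow> bool" where
  "separates r e f \<longleftrightarrow>
     (\<forall>x\<in>e. \<forall>y\<in>f. (x, y) \<in> r) \<or> (\<forall>x\<in>f. \<forall>y\<in>e. (x, y) \<in> r)"

definition separating_list :: "'a set \<Rightarrow> 'a set set \<Rightarrow> nat \<Rightarrow> 'a rel list \<Rightarrow> bool" where
  "separating_list V E t rs \<longleftrightarrow>
     (\<forall>r\<in>set rs. linear_order_on V r) \<and>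
     (\<forall>e\<in>E. \<forall>f\<in>E. nonincident e f \<longrightarrow> t \<le> length (filter (\<lambda>r. separates r e f) rs))"

text \<open>For finite \<open>V\<close>, any two disjoint edges are separated by some linear ordering, so separating
  lists exist for every \<open>t\<close> and the minimum below is attained.\<close>

definition sep_dim :: "nat \<Rightarrow> 'a set \<Rightarrow> 'a set set \<Rightarrow> nat" where
  "sep_dim t V E = (LEAST n. \<exists>rs. separating_list V E t rs \<and> length rs = n)"

definition frac_sep_dim :: "'a set \<Rightarrow> 'a set set \<Rightarrow> ereal" where
  "frac_sep_dim V E = liminf (\<lambda>t. ereal (real (sep_dim t V E) / real t))"

text \<open>The complete multipartite graph whose \<open>i\<close>-th part has size \<open>ns ! i\<close>; its vertex \<open>(i, j)\<close> is
  the \<open>j\<close>-th vertex of the \<open>i\<close>-th part.\<close>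

definition multipartite_verts :: "nat list \<Rightarrow> (nat \<times> nat) set" where
  "multipartite_verts ns = {(i, j). i < length ns \<and> j < ns ! i}"

definition multipartite_edges :: "nat list \<Rightarrow> (nat \<times> nat) set set" where
  "multipartite_edges ns =
     {{u, v} | u v. u \<in> multipartite_verts ns \<and> v \<in> multipartite_verts ns \<and> fst u \<noteq> fst v}"

end

theory Submission
  imports Defs "HOL-Combinatorics.Permutations"
begin

text \<open>
  By linear programming duality the fractional separation dimension is governed by the best
  probability with which a random ordering separates the worst pair of edges. Up to automorphisms
  there are two kinds of pairs: those of the form \<open>xa\<close>, \<open>a'b\<close> with \<open>x\<close> the apex, and those avoiding
  \<open>x\<close>. For the lower bound, only pairs of the first kind matter: if \<open>p\<close> and \<open>q\<close> vertices of the two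
  large parts lie to the right of \<open>x\<close>, then a lattice path argument bounds the number of separated
  pairs on each side of \<open>x\<close>, and the total is maximal when \<open>x\<close> sits in the middle of an alternating
  word. For the upper bound, averaging this alternating ordering over all automorphisms separates
  every pair of the first kind with exactly the extremal probability and every pair of the
  second kind with the probability \<open>(m + 1) / (3 m)\<close>, which is at least as large.
\<close>

section \<open>Counting the edges separated from a given edge\<close>

definition num_above :: "('a \<Rightarrow> int) \<Rightarrow> 'a set \<Rightarrow> int \<Rightarrow> int" where
  "num_above f S t = int (card {v \<in> S. t < f v})"

text \<open>A quadruple \<open>((a, b), (c, d))\<close> stands for the pair of edges \<open>ab\<close> and \<open>cd\<close>; an ordering is
  given by an injective position function \<open>f\<close>.\<close>

fun quad_sep :: "('a \<Rightarrow> int) \<Rightarrow> ('a \<times> 'a) \<times> ('a \<times> 'a) \<Rightarrow> bool" where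
  "quad_sep f ((a, b), (c, d)) \<longleftrightarrow>
     max (f a) (f b) < min (f c) (f d) \<or> max (f c) (f d) < min (f a) (f b)"

definition quads :: "('a \<times> 'a) set \<Rightarrow> 'a set \<Rightarrow> 'a set \<Rightarrow> (('a \<times> 'a) \<times> ('a \<times> 'a)) set" where
  "quads X A B = Sigma X (\<lambda>(a, b). (A - {a, b}) \<times> (B - {a, b}))"

text \<open>Counts the pairs in \<open>A \<times> B\<close> lying wholly beyond position
  \<open>t\<close>; with \<open>- f\<close> and \<open>- t\<close> it counts those lying wholly
  before it.\<close>

definition cross_above :: "('a \<Rightarrow> int) \<Rightarrow> 'a set \<Rightarrow> 'a set \<Rightarrow> int \<Rightarrow> int" where
  "cross_above f A B t = num_above f A t * num_above f B t"

lemma cross_above_commute: "cross_above f A B t = cross_above f B A t"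
  by (simp add: cross_above_def mult.commute)

lemma card_quads:
  assumes "finite X" "finite A" "finite B"
  shows "card (quads X A B) = (\<Sum>(a, b)\<in>X. card (A - {a, b}) * card (B - {a, b}))"
  unfolding quads_def using assms
  by (subst card_SigmaI) (auto simp: card_cartesian_product intro!: sum.cong)

text \<open>Fix the edge \<open>ab\<close>. A separated edge \<open>cd\<close> lies wholly beyond
  both ends of \<open>ab\<close> or wholly before them, never both. Strictness already excludes
  \<open>a\<close> and \<open>b\<close>, so the vertices removed in \<open>quads\<close> leave no
  trace in the formula.\<close>

lemma card_quad_sep:
  assumes "finite X" "finite A" "finite B"
  shows "int (card {q \<in> quads X A B. quad_sep f q}) =
    (\<Sum>(a, b)\<in>X. cross_above f A B (max (f a) (f b)) +
                  cross_above (\<lambda>v. - f v) A B (max (- f a) (- f b)))"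
proof -
  let ?U = "\<lambda>a b. {c \<in> A. max (f a) (f b) < f c} \<times> {d \<in> B. max (f a) (f b) < f d}"
  let ?L = "\<lambda>a b. {c \<in> A. max (- f a) (- f b) < - f c} \<times> {d \<in> B. max (- f a) (- f b) < - f d}"
  have "{q \<in> quads X A B. quad_sep f q} = Sigma X (\<lambda>(a, b). ?U a b \<union> ?L a b)"
    unfolding quads_def by force
  then have "card {q \<in> quads X A B. quad_sep f q} = (\<Sum>(a, b)\<in>X. card (?U a b \<union> ?L a b))"
    using assms card_SigmaI[of X "\<lambda>(a, b). ?U a b \<union> ?L a b"] by (simp add: case_prod_beta)
  moreover have "card (?U a b \<union> ?L a b) = card (?U a b) + card (?L a b)" for a b
    using assms by (intro card_Un_disjoint) auto
  ultimately show ?thesis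
    by (simp add: cross_above_def num_above_def card_cartesian_product case_prod_beta)
qed

section \<open>The extremal bound\<close>

text \<open>On one side of the apex, reading outward, each vertex contributes the number of \<open>A\<close>-vertices
  times the number of \<open>B\<close>-vertices beyond it. The maximum over all words with \<open>p\<close> letters \<open>A\<close> and
  \<open>q \<le> p\<close> letters \<open>B\<close> is attained by \<open>p - q\<close> letters \<open>A\<close> followed by an alternating word;
  \<open>path_bound\<close> is six times that value.\<close>

definition path_bound :: "int \<Rightarrow> int \<Rightarrow> int" where
  "path_bound p q = (if q \<le> p then 3 * p * (p - 1) * q + (q ^ 3 - q)
                     else 3 * q * (q - 1) * p + (p ^ 3 - p))"

lemma path_bound_commute: "path_bound p q = path_bound q p"
  by (auto simp: path_bound_def)

text \<open>An innermost letter \<open>A\<close> contributes \<open>(p - 1) * q\<close>. Equality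
  holds for \<open>q \<le> p\<close>, so opening with a letter of the larger part loses nothing; for
  \<open>q = p + k\<close> with \<open>k \<ge> 0\<close> the slack is
  \<open>3 * (k * (k + 1))\<close>.\<close>

lemma path_bound_step:
  assumes "1 \<le> p" "0 \<le> q"
  shows "6 * ((p - 1) * q) + path_bound (p - 1) q \<le> path_bound p q"
proof (cases "q \<le> p - 1")
  case True
  then show ?thesis by (simp add: path_bound_def algebra_simps power3_eq_cube)
next
  case False
  then obtain k where k: "q = p + int k"
    by (metis add.commute diff_add_cancel zle_iff_zadd zle_diff1_eq not_le)
  show ?thesis
  proof (cases "k = 0")
    case True
    then show ?thesis using k by (simp add: path_bound_def algebra_simps power3_eq_cube)
  next
    case False
    have "path_bound p q - path_bound (p - 1) q - 6 * ((p - 1) * q) = 3 * (int k * (int k + 1))"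
      using k False by (simp add: path_bound_def algebra_simps power3_eq_cube)
    moreover have "int k * (int k + 1) \<ge> 0" by simp
    ultimately show ?thesis by linarith
  qed
qed

text \<open>Induction that removes the vertex of least position. All others lie beyond it, and it
  lies beyond none of them, so their terms do not change and \<open>path_bound_step\<close> pays for
  its own term.\<close>

lemma sum_cross_above_le:
  assumes "finite A" "finite B" "A \<inter> B = {}" "inj_on f (A \<union> B)"
  shows "6 * (\<Sum>u\<in>A \<union> B. cross_above f A B (f u)) \<le> path_bound (int (card A)) (int (card B))"
  using assms
proof (induction "card (A \<union> B)" arbitrary: A B)
  case 0
  then show ?case by (simp add: path_bound_def)
next
  case (Suc n)
  \<comment> \<open>Stated for arbitrary \<open>A\<close> and \<open>B\<close> of this total size,
    so that a least vertex in \<open>B\<close> is handled by exchanging the two sets.\<close>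
  have step: "6 * (\<Sum>u\<in>A \<union> B. cross_above f A B (f u)) \<le> path_bound (int (card A)) (int (card B))"
    if fin: "finite A" "finite B" and dis: "A \<inter> B = {}" and inj: "inj_on f (A \<union> B)"
      and n: "Suc n = card (A \<union> B)" and a: "a \<in> A" and min: "\<And>u. u \<in> A \<union> B \<Longrightarrow> f a \<le> f u" for A B a
  proof -
    have less: "f a < f u" if "u \<in> A \<union> B" "u \<noteq> a" for u
      using min[OF that(1)] inj a that by (metis UnI1 inj_onD order_le_less)
    have aB: "a \<notin> B" using a dis by auto
    have 1: "A \<union> B = insert a ((A - {a}) \<union> B)" using a by auto
    have 2: "cross_above f A B (f u) = cross_above f (A - {a}) B (f u)" if "u \<in> (A - {a}) \<union> B" for u
    proof -
      have "{v \<in> A. f u < f v} = {v \<in> A - {a}. f u < f v}" using min[of u] that by force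
      then show ?thesis by (simp add: cross_above_def num_above_def)
    qed
    have "{v \<in> A. f a < f v} = A - {a}" "{v \<in> B. f a < f v} = B" using less aB by force+
    then have 3: "cross_above f A B (f a) = (int (card A) - 1) * int (card B)"
      using a fin by (simp add: cross_above_def num_above_def of_nat_diff card_gt_0_iff Suc_leI)
       (metis One_nat_def Suc_leI card_gt_0_iff empty_iff of_nat_1 of_nat_diff)
    have "card ((A - {a}) \<union> B) = n" using n 1 fin aB by simp
    then have IH: "6 * (\<Sum>u\<in>(A - {a}) \<union> B. cross_above f (A - {a}) B (f u))
        \<le> path_bound (int (card (A - {a}))) (int (card B))"
      using fin dis inj by (intro Suc.hyps(1)) (auto elim: inj_on_subset)
    have pos: "card A > 0" using a fin by (auto simp: card_gt_0_iff)
    have "(\<Sum>u\<in>A \<union> B. cross_above f A B (f u)) =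
        cross_above f A B (f a) + (\<Sum>u\<in>(A - {a}) \<union> B. cross_above f (A - {a}) B (f u))"
      by (subst 1, subst sum.insert) (use fin aB 2 in \<open>auto intro!: sum.cong\<close>)
    moreover have "6 * ((int (card A) - 1) * int (card B)) + path_bound (int (card A) - 1) (int (card B))
        \<le> path_bound (int (card A)) (int (card B))"
      using pos by (intro path_bound_step) auto
    ultimately show ?thesis using IH 3 a fin pos by (simp add: of_nat_diff Suc_leI)
  qed
  have "A \<union> B \<noteq> {}" using Suc.hyps(2) by auto
  then obtain a where a: "a \<in> A \<union> B" "\<And>u. u \<in> A \<union> B \<Longrightarrow> f a \<le> f u"
    using ex_min_if_finite[of "f ` (A \<union> B)"] Suc.prems
    by (metis (no_types, lifting) arg_min_if_finite(1) arg_min_least finite_UnI)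
  show ?case
  proof (cases "a \<in> A")
    case True
    then show ?thesis using step[of A B a] Suc a by auto
  next
    case False
    then have "a \<in> B" using a by auto
    then have "6 * (\<Sum>u\<in>B \<union> A. cross_above f B A (f u)) \<le> path_bound (int (card B)) (int (card A))"
      using Suc.prems Suc.hyps(2) a by (intro step[of B A a]) (auto simp: Un_commute Int_commute)
    then show ?thesis
      by (simp add: Un_commute cross_above_commute[of f B A] path_bound_commute)
  qed
qed

text \<open>Think of \<open>t\<close> as the position of the apex. Every \<open>u\<close> before it
  contributes the same \<open>p * q\<close>, while the \<open>u\<close> beyond it see only one
  another and fall under \<open>sum_cross_above_le\<close>.\<close>

lemma sum_cross_above_max_le:
  assumes "finite A" "finite B" "A \<inter> B = {}" "inj_on f (A \<union> B)"
    and "p = num_above f A t" "q = num_above f B t"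
  shows "6 * (\<Sum>u\<in>A \<union> B. cross_above f A B (max t (f u)))
    \<le> 6 * ((int (card A) + int (card B) - p - q) * (p * q)) + path_bound p q"
proof -
  define A1 B1 where "A1 = {v \<in> A. t < f v}" and "B1 = {v \<in> B. t < f v}"
  have fin: "finite A1" "finite B1" and dis: "A1 \<inter> B1 = {}" and inj: "inj_on f (A1 \<union> B1)"
    using assms by (auto simp: A1_def B1_def elim: inj_on_subset)
  have pq: "p = int (card A1)" "q = int (card B1)"
    using assms by (auto simp: A1_def B1_def num_above_def)
  have sub: "A1 \<union> B1 \<subseteq> A \<union> B" by (auto simp: A1_def B1_def)
  have in_eq: "cross_above f A B (max t (f u)) = cross_above f A1 B1 (f u)" if "u \<in> A1 \<union> B1" for u
  proof -
    have "{v \<in> A. max t (f u) < f v} = {v \<in> A1. f u < f v}"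
         "{v \<in> B. max t (f u) < f v} = {v \<in> B1. f u < f v}"
      using that by (auto simp: A1_def B1_def)
    then show ?thesis by (simp add: cross_above_def num_above_def)
  qed
  have out_eq: "cross_above f A B (max t (f u)) = p * q" if "u \<in> (A \<union> B) - (A1 \<union> B1)" for u
  proof -
    have "max t (f u) = t" using that by (auto simp: A1_def B1_def)
    then show ?thesis by (simp add: cross_above_def assms)
  qed
  have "int (card ((A \<union> B) - (A1 \<union> B1))) = int (card A) + int (card B) - p - q"
    using assms(1-3) fin dis sub card_mono[OF _ sub]
      card_Un_disjoint[of A B] card_Un_disjoint[of A1 B1]
    by (simp add: card_Diff_subset pq of_nat_diff)
  moreover have "(\<Sum>u\<in>A \<union> B. cross_above f A B (max t (f u))) =
     (\<Sum>u\<in>(A \<union> B) - (A1 \<union> B1). p * q) + (\<Sum>u\<in>A1 \<union> B1. cross_above f A1 B1 (f u))"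
    using sub assms(1,2) in_eq out_eq by (subst sum.subset_diff[OF sub]) (auto intro!: sum.cong)
  ultimately show ?thesis using sum_cross_above_le[OF fin dis inj] pq by simp
qed

text \<open>With \<open>d = p - q\<close> and \<open>s = p + q - m\<close>, for
  \<open>q \<le> p\<close> the left side falls short of \<open>8 * m ^ 3 - 3 * m ^ 2 - 2 * m\<close>
  by \<open>6 * m * d^2 - 3 * d^2 + 3 * s^2 + 2 * (d ^ 3 - d)\<close>. The other case follows by
  exchanging the parts.\<close>

lemma path_bound_total_le:
  fixes p q p' q' :: int
  assumes m: "p + p' = m" "q + q' = m" "1 \<le> m"
  shows "2 * (6 * ((p' + q') * (p * q)) + path_bound p q + 6 * ((p + q) * (p' * q')) + path_bound p' q')
    \<le> 8 * m ^ 3 - 3 * m ^ 2 - 2 * m - (if odd m then 3 else 0)"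
proof -
  have main: "2 * (6 * ((p' + q') * (p * q)) + path_bound p q + 6 * ((p + q) * (p' * q')) + path_bound p' q')
    \<le> 8 * m ^ 3 - 3 * m ^ 2 - 2 * m - (if odd m then 3 else 0)"
    if m: "p + p' = m" "q + q' = m" and le: "q \<le> p" for p q p' q' :: int
  proof -
    (* d and s measure how far the apex is from splitting both parts in half; m odd and d = 0 force s \<noteq> 0 *)
    define d s where "d = p - q" and "s = p + q - m"
    have p': "p' = m - p" "q' = m - q" using m by auto
    have le': "p' \<le> q'" using le p' by simp
    have pb: "path_bound p' q' = 3 * q' * (q' - 1) * p' + (p' ^ 3 - p')"
      using le' by (auto simp: path_bound_def)
    have eq: "2 * (6 * ((p' + q') * (p * q)) + path_bound p q + 6 * ((p + q) * (p' * q')) + path_bound p' q')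
      = 8 * m ^ 3 - 3 * m ^ 2 - 2 * m - 6 * (m * d\<^sup>2) + 3 * d\<^sup>2 - 3 * s\<^sup>2 - 2 * (d ^ 3 - d)"
      unfolding pb using le unfolding path_bound_def p' d_def s_def
      by (simp add: power2_eq_square power3_eq_cube algebra_simps)
    have d0: "0 \<le> d" using le by (simp add: d_def)
    have md: "d\<^sup>2 \<le> m * d\<^sup>2" using assms(3) mult_right_mono[of 1 m "d\<^sup>2"] by simp
    have s0: "s\<^sup>2 \<ge> 0" by simp
    show ?thesis
    proof (cases "d = 0")
      case True
      have "s\<^sup>2 \<ge> 1" if "odd m"
      proof -
        have "s \<noteq> 0" using that True by (auto simp: d_def s_def)
        then show ?thesis by (simp add: int_one_le_iff_zero_less)
      qed
      then show ?thesis using eq True s0 by auto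
    next
      case False
      then have d1: "1 \<le> d" using d0 by simp
      then have "1 \<le> d\<^sup>2" by simp
      moreover have "d \<le> d ^ 3" using d1 self_le_power[of d 3] by simp
      \<comment> \<open>Since \<open>1 \<le> m\<close>, the shortfall is at least
        \<open>3 * d^2\<close>, hence at least 3, which covers the extra term for odd
        \<open>m\<close>.\<close>
      ultimately have "6 * (m * d\<^sup>2) - 3 * d\<^sup>2 + 3 * s\<^sup>2 + 2 * (d ^ 3 - d) \<ge> 3"
        using md s0 by (smt (verit))
      then show ?thesis using eq by (smt (verit))
    qed
  qed
  show ?thesis
  proof (cases "q \<le> p")
    case True
    then show ?thesis using main m by blast
  next
    case False
    then show ?thesis using main[of q q' p p'] m
      by (simp add: path_bound_commute[of q p] path_bound_commute[of q' p'] algebra_simps)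
  qed
qed

section \<open>Orderings of the complete tripartite graph\<close>

(* Keeps the part index 1 from being rewritten to Suc 0. *)
declare One_nat_def [simp del]

definition order_of :: "'a set \<Rightarrow> ('a \<Rightarrow> int) \<Rightarrow> 'a rel" where
  "order_of V f = {(u, v). u \<in> V \<and> v \<in> V \<and> f u \<le> f v}"

lemma linear_order_on_order_of: "inj_on f V \<Longrightarrow> linear_order_on V (order_of V f)"
  unfolding linear_order_on_def partial_order_on_def preorder_on_def order_of_def
  by (auto simp: refl_on_def trans_def antisym_def total_on_def inj_on_def)

lemma linear_order_on_eq_order_of:
  assumes "finite V" "linear_order_on V r"
  obtains f where "inj_on f V" "r = order_of V f"
proof -
  \<comment> \<open>The rank of \<open>v\<close>: its number of predecessors, \<open>v\<close>
    included. Strictly smaller vertices have strictly smaller down-sets, so ranks recover the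
    order.\<close>
  define f where "f v = int (card {u \<in> V. (u, v) \<in> r})" for v
  have sub: "r \<subseteq> V \<times> V" and refl: "\<And>v. v \<in> V \<Longrightarrow> (v, v) \<in> r"
    and tr: "trans r" and anti: "antisym r" and tot: "total_on V r"
    using assms(2)
    by (auto simp: linear_order_on_def partial_order_on_def preorder_on_def refl_on_def)
  have iff: "(u, v) \<in> r \<longleftrightarrow> f u \<le> f v" if uv: "u \<in> V" "v \<in> V" for u v
  proof
    assume "(u, v) \<in> r"
    then show "f u \<le> f v"
      unfolding f_def using assms(1) tr by (auto intro!: card_mono dest: transD)
  next
    assume le: "f u \<le> f v"
    show "(u, v) \<in> r"
    proof (rule ccontr)
      assume n: "(u, v) \<notin> r"
      then have "(v, u) \<in> r" using tot uv refl by (metis total_on_def)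
      then have "{w \<in> V. (w, v) \<in> r} \<subset> {w \<in> V. (w, u) \<in> r}"
        using n uv refl tr by (auto dest: transD)
      then have "card {w \<in> V. (w, v) \<in> r} < card {w \<in> V. (w, u) \<in> r}"
        using assms(1) by (intro psubset_card_mono) auto
      then show False using le unfolding f_def by simp
    qed
  qed
  have "inj_on f V" using iff anti by (intro inj_onI) (metis antisymD order_refl)
  moreover have "r = order_of V f" using iff sub by (auto simp: order_of_def)
  ultimately show ?thesis by (rule that)
qed

text \<open>\<open>order_of\<close> compares weakly and \<open>quad_sep\<close> strictly; the two
  agree because the edges share no endpoint and \<open>f\<close> is injective.\<close>

lemma separates_order_of:
  assumes "inj_on f V" "a \<in> V" "b \<in> V" "c \<in> V" "d \<in> V" "{a, b} \<inter> {c, d} = {}"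
  shows "separates (order_of V f) {a, b} {c, d} \<longleftrightarrow> quad_sep f ((a, b), (c, d))"
proof -
  have "f a \<noteq> f c" "f a \<noteq> f d" "f b \<noteq> f c" "f b \<noteq> f d"
    using assms by (auto simp: inj_on_eq_iff)
  then show ?thesis using assms(2-5) by (auto simp: separates_def order_of_def)
qed

section \<open>The vertex set and the two kinds of edge pairs\<close>

definition tripart :: "nat \<Rightarrow> nat \<Rightarrow> (nat \<times> nat) set" where
  "tripart m i = Pair i ` {..<m}"

definition apex :: "nat \<times> nat" where
  "apex = (0, 0)"

definition verts :: "nat \<Rightarrow> (nat \<times> nat) set" where
  "verts m = insert apex (tripart m 1 \<union> tripart m 2)"

lemma finite_tripart [simp]: "finite (tripart m i)"
  by (simp add: tripart_def)

lemma card_tripart [simp]: "card (tripart m i) = m"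
  by (simp add: tripart_def card_image inj_on_def)

lemma mem_tripart_iff: "v \<in> tripart m i \<longleftrightarrow> fst v = i \<and> snd v < m"
  by (cases v) (auto simp: tripart_def)

lemma tripart_disjoint: "i \<noteq> j \<Longrightarrow> tripart m i \<inter> tripart m j = {}"
  by (auto simp: mem_tripart_iff)

lemma apex_notin_tripart: "i \<noteq> 0 \<Longrightarrow> apex \<notin> tripart m i"
  by (auto simp: mem_tripart_iff apex_def)

lemma finite_verts [simp]: "finite (verts m)"
  by (simp add: verts_def)

lemma verts_eq: "verts m = multipartite_verts [1, m, m]"
proof -
  have "i < length [1, m, m] \<and> j < [1, m, m] ! i \<longleftrightarrow> (i, j) \<in> verts m" for i j
    by (cases i; cases "i - 1"; cases "i - 2")
       (auto simp: verts_def mem_tripart_iff apex_def nth_Cons' One_nat_def)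
  then show ?thesis
    by (auto simp: multipartite_verts_def)
qed

text \<open>Putting \<open>c\<close> in the part of \<open>b\<close> fixes the order of all four
  entries, so each nonincident pair with an edge at the apex is listed exactly once.\<close>

definition apex_quads :: "nat \<Rightarrow> (((nat \<times> nat) \<times> (nat \<times> nat)) \<times> ((nat \<times> nat) \<times> (nat \<times> nat))) set" where
  "apex_quads m = quads ({apex} \<times> tripart m 1) (tripart m 1) (tripart m 2)
                \<union> quads ({apex} \<times> tripart m 2) (tripart m 2) (tripart m 1)"

text \<open>Each nonincident pair avoiding the apex is listed four times: either edge may come
  first, and either part may supply the first endpoints. Allowing both parts makes the set stable
  under exchanging them.\<close>

definition base_quads :: "nat \<Rightarrow> (((nat \<times> nat) \<times> (nat \<times> nat)) \<times> ((nat \<times> nat) \<times> (nat \<times> nat))) set" where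
  "base_quads m = quads (tripart m 1 \<times> tripart m 2) (tripart m 1) (tripart m 2)
                \<union> quads (tripart m 2 \<times> tripart m 1) (tripart m 2) (tripart m 1)"

lemma finite_quads [simp]: "finite X \<Longrightarrow> finite A \<Longrightarrow> finite B \<Longrightarrow> finite (quads X A B)"
  by (auto simp: quads_def)

lemma finite_apex_quads [simp]: "finite (apex_quads m)"
  by (simp add: apex_quads_def)

lemma finite_base_quads [simp]: "finite (base_quads m)"
  by (simp add: base_quads_def)

lemma quads_disjoint: "A \<inter> B = {} \<Longrightarrow> quads X A B \<inter> quads Y B A = {}"
  by (auto simp: quads_def)

lemma card_filter_quads_Un:
  assumes "finite X" "finite Y" "finite A" "finite B" "A \<inter> B = {}"
  shows "card {q \<in> quads X A B \<union> quads Y B A. P q} =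
    card {q \<in> quads X A B. P q} + card {q \<in> quads Y B A. P q}"
proof -
  have "{q \<in> quads X A B \<union> quads Y B A. P q} = {q \<in> quads X A B. P q} \<union> {q \<in> quads Y B A. P q}"
    by auto
  then show ?thesis
    using assms quads_disjoint[OF assms(5), of X Y] by (auto intro!: card_Un_disjoint)
qed

lemma card_apex_quads: "card (apex_quads m) = 2 * (m * m * (m - 1))"
proof -
  have "card (quads ({apex} \<times> tripart m i) (tripart m i) (tripart m j)) = m * m * (m - 1)"
    if "i \<noteq> j" "i \<noteq> 0" "j \<noteq> 0" for i j
  proof -
    have "card (quads ({apex} \<times> tripart m i) (tripart m i) (tripart m j))
      = (\<Sum>(a, b)\<in>{apex} \<times> tripart m i. card (tripart m i - {a, b}) * card (tripart m j - {a, b}))"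
      by (rule card_quads) auto
    also have "\<dots> = (\<Sum>(a, b)\<in>{apex} \<times> tripart m i. (m - 1) * m)"
    proof (intro sum.cong refl)
      fix ab assume "ab \<in> {apex} \<times> tripart m i"
      then obtain b where ab: "ab = (apex, b)" and b: "b \<in> tripart m i" by auto
      then have "tripart m i - {apex, b} = tripart m i - {b}" "tripart m j - {apex, b} = tripart m j"
        using apex_notin_tripart[of i m] apex_notin_tripart[of j m] tripart_disjoint[of i j m] that by auto
      then show "(case ab of (a, b) \<Rightarrow> card (tripart m i - {a, b}) * card (tripart m j - {a, b}))
          = (case ab of (a, b) \<Rightarrow> (m - 1) * m)"
        using b by (simp add: ab card_Diff_singleton)
    qed
    also have "\<dots> = m * m * (m - 1)" by (simp add: card_cartesian_product case_prod_beta)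
    finally show ?thesis .
  qed
  then show ?thesis
    using card_filter_quads_Un[of "{apex} \<times> tripart m 1" "{apex} \<times> tripart m 2" "tripart m 1" "tripart m 2" "\<lambda>_. True"]
      tripart_disjoint[of 1 2 m] by (simp add: apex_quads_def Un_def)
qed

lemma card_base_quads: "card (base_quads m) = 2 * (m * (m - 1))\<^sup>2"
proof -
  have "card (quads (tripart m i \<times> tripart m j) (tripart m i) (tripart m j)) = (m * (m - 1))\<^sup>2"
    if "i \<noteq> j" for i j
  proof -
    have "card (quads (tripart m i \<times> tripart m j) (tripart m i) (tripart m j))
      = (\<Sum>(a, b)\<in>tripart m i \<times> tripart m j. card (tripart m i - {a, b}) * card (tripart m j - {a, b}))"
      by (rule card_quads) auto
    also have "\<dots> = (\<Sum>(a, b)\<in>tripart m i \<times> tripart m j. (m - 1) * (m - 1))"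
    proof (intro sum.cong refl, clarify)
      fix a b assume ab: "a \<in> tripart m i" "b \<in> tripart m j"
      then have "tripart m i - {a, b} = tripart m i - {a}" "tripart m j - {a, b} = tripart m j - {b}"
        using tripart_disjoint[of i j m] that by auto
      then show "card (tripart m i - {a, b}) * card (tripart m j - {a, b}) = (m - 1) * (m - 1)"
        using ab by simp
    qed
    also have "\<dots> = (m * (m - 1))\<^sup>2"
      by (simp add: card_cartesian_product case_prod_beta power2_eq_square)
    finally show ?thesis .
  qed
  then show ?thesis
    using card_filter_quads_Un[of "tripart m 1 \<times> tripart m 2" "tripart m 2 \<times> tripart m 1" "tripart m 1" "tripart m 2" "\<lambda>_. True"]
      tripart_disjoint[of 1 2 m] by (simp add: base_quads_def Un_def)
qed

text \<open>Symmetry of \<open>cross_above\<close> in the two parts merges the halves of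
  \<open>apex_quads\<close> into one sum over the other endpoint \<open>u\<close> of the apex
  edge.\<close>

lemma card_apex_quads_sep:
  "int (card {q \<in> apex_quads m. quad_sep f q}) =
    (\<Sum>u\<in>tripart m 1 \<union> tripart m 2. cross_above f (tripart m 1) (tripart m 2) (max (f apex) (f u))) +
    (\<Sum>u\<in>tripart m 1 \<union> tripart m 2. cross_above (\<lambda>v. - f v) (tripart m 1) (tripart m 2) (max (- f apex) (- f u)))"
proof -
  have *: "(\<Sum>(a, b)\<in>{apex} \<times> X. h a b) = (\<Sum>u\<in>X. h apex u)" for X and h :: "_ \<Rightarrow> _ \<Rightarrow> int"
    by (subst sum.cartesian_product[symmetric]) simp
  show ?thesis
    unfolding apex_quads_def
    by (subst card_filter_quads_Un)
       (simp_all add: tripart_disjoint card_quad_sep * sum.distrib sum.union_disjoint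
          cross_above_commute[of _ "tripart m 2" "tripart m 1"])
qed

text \<open>Twelve times the largest number of quadruples in \<open>apex_quads m\<close> that one ordering separates.\<close>

definition extremal_count :: "nat \<Rightarrow> int" where
  "extremal_count m = 8 * int m ^ 3 - 3 * (int m)\<^sup>2 - 2 * int m - (if odd m then 3 else 0)"

text \<open>Negating \<open>f\<close> turns edges before the apex into edges beyond it. Every vertex
  of a large part lies on exactly one side of the apex, so the two counts in each part add up to
  \<open>m\<close> and \<open>path_bound_total_le\<close> applies.\<close>

lemma card_apex_quads_sep_le:
  assumes "inj_on f (verts m)" "1 \<le> m"
  shows "12 * int (card {q \<in> apex_quads m. quad_sep f q}) \<le> extremal_count m"
proof -
  let ?A = "tripart m 1" and ?B = "tripart m 2" and ?g = "\<lambda>v. - f v"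
  have inj: "inj_on f (?A \<union> ?B)" "inj_on ?g (?A \<union> ?B)"
    using assms(1) by (auto simp: verts_def inj_on_def)
  have split: "num_above f (tripart m i) (f apex) + num_above ?g (tripart m i) (?g apex) = int m"
    if "i = 1 \<or> i = 2" for i
  proof -
    have "tripart m i = {v \<in> tripart m i. f apex < f v} \<union> {v \<in> tripart m i. f v < f apex}"
      using assms(1) that apex_notin_tripart[of i m] by (auto simp: verts_def inj_on_def neq_iff)
    then have "m = card ({v \<in> tripart m i. f apex < f v} \<union> {v \<in> tripart m i. f v < f apex})"
      by (metis card_tripart)
    also have "\<dots> = card {v \<in> tripart m i. f apex < f v} + card {v \<in> tripart m i. f v < f apex}"
      by (intro card_Un_disjoint) auto
    finally show ?thesis by (simp add: num_above_def)
  qed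
  define p q p' q' where "p = num_above f ?A (f apex)" and "q = num_above f ?B (f apex)"
    and "p' = num_above ?g ?A (?g apex)" and "q' = num_above ?g ?B (?g apex)"
  have m: "p + p' = int m" "q + q' = int m"
    using split by (auto simp: p_def q_def p'_def q'_def)
  have dis: "?A \<inter> ?B = {}" by (simp add: tripart_disjoint)
  have e: "int m + int m - p - q = p' + q'" "int m + int m - p' - q' = p + q"
    using m by auto
  have "6 * (\<Sum>u\<in>?A \<union> ?B. cross_above f ?A ?B (max (f apex) (f u)))
      \<le> 6 * ((p' + q') * (p * q)) + path_bound p q"
    using sum_cross_above_max_le[OF _ _ dis inj(1) p_def q_def] unfolding e(1)[symmetric] by simp
  moreover have "6 * (\<Sum>u\<in>?A \<union> ?B. cross_above ?g ?A ?B (max (?g apex) (?g u)))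
      \<le> 6 * ((p + q) * (p' * q')) + path_bound p' q'"
    using sum_cross_above_max_le[OF _ _ dis inj(2) p'_def q'_def] e by simp
  moreover have "2 * (6 * ((p' + q') * (p * q)) + path_bound p q + 6 * ((p + q) * (p' * q')) + path_bound p' q')
      \<le> extremal_count m"
    using path_bound_total_le[OF m] assms(2) by (simp add: extremal_count_def)
  ultimately show ?thesis
    unfolding card_apex_quads_sep by (smt (verit))
qed

section \<open>The alternating ordering\<close>

text \<open>The ordering \<open>ABAB\<dots>xABAB\<dots>\<close> with the apex \<open>x\<close> after \<open>m div 2\<close> blocks.\<close>

definition alt_pos :: "nat \<Rightarrow> nat \<times> nat \<Rightarrow> int" where
  "alt_pos m v = (if fst v = 0 then 4 * int (m div 2) else 4 * int (snd v) + int (fst v))"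

text \<open>The residue of a position modulo 4 is the part index, so different parts never
  collide.\<close>

lemma inj_on_alt_pos: "inj_on (alt_pos m) (verts m)"
proof (rule inj_onI)
  fix u v assume "u \<in> verts m" "v \<in> verts m" "alt_pos m u = alt_pos m v"
  then show "u = v"
    by (cases u; cases v)
       (auto simp: verts_def mem_tripart_iff apex_def alt_pos_def; presburger)
qed

lemma sum_tripart: "sum h (tripart m i) = (\<Sum>j<m. h (i, j))"
  by (simp add: tripart_def sum.reindex inj_on_def)

lemma num_above_tripart: "num_above f (tripart m i) t = int (card {j. j < m \<and> t < f (i, j)})"
proof -
  have "{v \<in> tripart m i. t < f v} = Pair i ` {j. j < m \<and> t < f (i, j)}"
    by (auto simp: tripart_def)
  then show ?thesis by (simp add: num_above_def card_image inj_on_def)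
qed

text \<open>\<open>k\<close> is the index of the first vertex of part \<open>i\<close> beyond
  \<open>t\<close> (\<open>k = m\<close> if there is none); each threshold then needs only an
  arithmetic check.\<close>

lemma num_above_alt_pos:
  assumes "k \<le> m" "i = 1 \<or> i = 2" "\<And>j. t < 4 * int j + int i \<longleftrightarrow> k \<le> j"
  shows "num_above (alt_pos m) (tripart m i) t = int m - int k"
proof -
  have "{j. j < m \<and> t < alt_pos m (i, j)} = {k..<m}"
  proof -
    have "alt_pos m (i, j) = 4 * int j + int i" for j
      using assms(2) by (auto simp: alt_pos_def)
    then show ?thesis by (simp only: assms(3)) auto
  qed
  then show ?thesis using assms(1) by (simp add: num_above_tripart of_nat_diff)
qed

lemma num_below_alt_pos:
  assumes "k \<le> m" "i = 1 \<or> i = 2" "\<And>j. t < - (4 * int j + int i) \<longleftrightarrow> j < k"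
  shows "num_above (\<lambda>v. - alt_pos m v) (tripart m i) t = int k"
proof -
  have "{j. j < m \<and> t < - alt_pos m (i, j)} = {..<k}"
  proof -
    have "alt_pos m (i, j) = 4 * int j + int i" for j
      using assms(2) by (auto simp: alt_pos_def)
    then show ?thesis using assms(1) by (simp only: assms(3)) auto
  qed
  then show ?thesis by (simp add: num_above_tripart)
qed

text \<open>The thresholds are a block boundary, where the apex sits, and the positions of
  \<open>(1, j)\<close> and \<open>(2, j)\<close>. The factors differ at \<open>(1, j)\<close>
  because its block mate \<open>(2, j)\<close> still lies beyond it.\<close>

lemma cross_above_alt_pos:
  "n \<le> m \<Longrightarrow> cross_above (alt_pos m) (tripart m 1) (tripart m 2) (4 * int n)
      = (int m - int n) * (int m - int n)"
  "j < m \<Longrightarrow> cross_above (alt_pos m) (tripart m 1) (tripart m 2) (4 * int j + 1)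
      = (int m - 1 - int j) * (int m - int j)"
  "j < m \<Longrightarrow> cross_above (alt_pos m) (tripart m 1) (tripart m 2) (4 * int j + 2)
      = (int m - 1 - int j) * (int m - 1 - int j)"
proof -
  assume "n \<le> m"
  then have "num_above (alt_pos m) (tripart m 1) (4 * int n) = int m - int n"
    "num_above (alt_pos m) (tripart m 2) (4 * int n) = int m - int n"
    by (intro num_above_alt_pos; force)+
  then show "cross_above (alt_pos m) (tripart m 1) (tripart m 2) (4 * int n)
      = (int m - int n) * (int m - int n)" by (simp add: cross_above_def)
next
  assume j: "j < m"
  then have "num_above (alt_pos m) (tripart m 1) (4 * int j + 1) = int m - int (Suc j)"
    "num_above (alt_pos m) (tripart m 1) (4 * int j + 2) = int m - int (Suc j)"
    "num_above (alt_pos m) (tripart m 2) (4 * int j + 2) = int m - int (Suc j)"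
    by (intro num_above_alt_pos; force)+
  moreover have "num_above (alt_pos m) (tripart m 2) (4 * int j + 1) = int m - int j"
    using j by (intro num_above_alt_pos; force)
  ultimately show "cross_above (alt_pos m) (tripart m 1) (tripart m 2) (4 * int j + 1)
      = (int m - 1 - int j) * (int m - int j)"
    "cross_above (alt_pos m) (tripart m 1) (tripart m 2) (4 * int j + 2)
      = (int m - 1 - int j) * (int m - 1 - int j)"
    unfolding cross_above_def by (simp_all only: of_nat_Suc diff_diff_eq add.commute)
qed

text \<open>Read from the right, \<open>(1, j)\<close> lies beyond its mate \<open>(2, j)\<close>,
  so the uneven product now occurs at the second letter.\<close>

lemma cross_below_alt_pos:
  "n \<le> m \<Longrightarrow> cross_above (\<lambda>v. - alt_pos m v) (tripart m 1) (tripart m 2) (- (4 * int n))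
      = int n * int n"
  "j < m \<Longrightarrow> cross_above (\<lambda>v. - alt_pos m v) (tripart m 1) (tripart m 2) (- (4 * int j + 1))
      = int j * int j"
  "j < m \<Longrightarrow> cross_above (\<lambda>v. - alt_pos m v) (tripart m 1) (tripart m 2) (- (4 * int j + 2))
      = (int j + 1) * int j"
proof -
  assume "n \<le> m"
  then have "num_above (\<lambda>v. - alt_pos m v) (tripart m 1) (- (4 * int n)) = int n"
    "num_above (\<lambda>v. - alt_pos m v) (tripart m 2) (- (4 * int n)) = int n"
    by (intro num_below_alt_pos; force)+
  then show "cross_above (\<lambda>v. - alt_pos m v) (tripart m 1) (tripart m 2) (- (4 * int n))
      = int n * int n" by (simp add: cross_above_def)
next
  assume j: "j < m"
  then have "num_above (\<lambda>v. - alt_pos m v) (tripart m 1) (- (4 * int j + 1)) = int j"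
    "num_above (\<lambda>v. - alt_pos m v) (tripart m 2) (- (4 * int j + 1)) = int j"
    "num_above (\<lambda>v. - alt_pos m v) (tripart m 2) (- (4 * int j + 2)) = int j"
    by (intro num_below_alt_pos; force)+
  moreover have "num_above (\<lambda>v. - alt_pos m v) (tripart m 1) (- (4 * int j + 2)) = int (Suc j)"
    using j by (intro num_below_alt_pos; force)
  ultimately show "cross_above (\<lambda>v. - alt_pos m v) (tripart m 1) (tripart m 2) (- (4 * int j + 1))
      = int j * int j"
    "cross_above (\<lambda>v. - alt_pos m v) (tripart m 1) (tripart m 2) (- (4 * int j + 2))
      = (int j + 1) * int j"
    unfolding cross_above_def by (simp_all only: of_nat_Suc add.commute)
qed

lemma sum_lessThan_add: "(\<Sum>j<n + k. h j) = (\<Sum>j<n. h j) + (\<Sum>j<k. h (n + j))"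
  for h :: "nat \<Rightarrow> int"
  by (induction k) auto

lemma sum_alternating_squares:
  "6 * (\<Sum>j<n. c + (int j * int j + (int j + 1) * int j)) =
    6 * int n * c + int n * (int n - 1) * (4 * int n + 1)"
  by (induction n) (auto simp: algebra_simps)

text \<open>Each of the two vertices of a block before the apex sees the \<open>k * k\<close> edges
  beyond the apex and the edges further out on its own side; blocks beyond the apex see
  \<open>n * n\<close> likewise. As \<open>k\<close> is \<open>n\<close> or \<open>n + 1\<close>,
  the total meets the upper bound.\<close>

lemma card_apex_quads_sep_alt_pos:
  "12 * int (card {q \<in> apex_quads m. quad_sep (alt_pos m) q}) = extremal_count m"
proof -
  define n k where "n = m div 2" and "k = m - n"
  have m: "m = n + k" and nm: "n \<le> m" by (auto simp: n_def k_def)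
  let ?A = "tripart m 1" and ?B = "tripart m 2" and ?f = "alt_pos m"
  let ?U = "cross_above ?f ?A ?B" and ?D = "cross_above (\<lambda>v. - ?f v) ?A ?B"
  have ap: "?f apex = 4 * int n" "?f (1, j) = 4 * int j + 1" "?f (2, j) = 4 * int j + 2" for j
    by (auto simp: alt_pos_def apex_def n_def)
  define h where "h j = ?U (max (4 * int n) (4 * int j + 1)) + ?U (max (4 * int n) (4 * int j + 2))
    + (?D (max (- (4 * int n)) (- (4 * int j + 1))) + ?D (max (- (4 * int n)) (- (4 * int j + 2))))" for j
  have S: "int (card {q \<in> apex_quads m. quad_sep ?f q}) = (\<Sum>j<m. h j)"
    unfolding card_apex_quads_sep h_def
    by (simp add: sum.union_disjoint tripart_disjoint sum_tripart ap sum.distrib)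
  have low: "h j = 2 * int k * int k + (int j * int j + (int j + 1) * int j)" if "j < n" for j
  proof -
    have "max (4 * int n) (4 * int j + 1) = 4 * int n" "max (4 * int n) (4 * int j + 2) = 4 * int n"
      "max (- (4 * int n)) (- (4 * int j + 1)) = - (4 * int j + 1)"
      "max (- (4 * int n)) (- (4 * int j + 2)) = - (4 * int j + 2)"
      using that by auto
    then show ?thesis unfolding h_def
      using that nm by (simp only: cross_above_alt_pos cross_below_alt_pos) (simp add: m cross_below_alt_pos)
  qed
  \<comment> \<open>Blocks beyond the apex are numbered from the outer end, which gives both sides
    the same form of summand for \<open>sum_alternating_squares\<close>.\<close>
  have high: "h (n + (k - Suc j)) = 2 * int n * int n + (int j * int j + (int j + 1) * int j)"
    if "j < k" for j
  proof -
    define l where "l = n + (k - Suc j)"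
    have "max (4 * int n) (4 * int l + 1) = 4 * int l + 1" "max (4 * int n) (4 * int l + 2) = 4 * int l + 2"
      "max (- (4 * int n)) (- (4 * int l + 1)) = - (4 * int n)"
      "max (- (4 * int n)) (- (4 * int l + 2)) = - (4 * int n)"
      by (auto simp: l_def)
    moreover have "l < m" "int m - 1 - int l = int j" "int m - int l = int j + 1"
      using that m by (auto simp: l_def)
    ultimately show ?thesis unfolding h_def l_def[symmetric]
      using nm by (simp only: cross_above_alt_pos cross_below_alt_pos) (simp add: algebra_simps)
  qed
  have "(\<Sum>j<m. h j) = (\<Sum>j<n. h j) + (\<Sum>j<k. h (n + (k - Suc j)))"
    unfolding m sum_lessThan_add using sum.nat_diff_reindex[of "\<lambda>j. h (n + j)" k] by simp
  also have "\<dots> = (\<Sum>j<n. 2 * int k * int k + (int j * int j + (int j + 1) * int j)) +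
      (\<Sum>j<k. 2 * int n * int n + (int j * int j + (int j + 1) * int j))"
    using low high by (intro arg_cong2[where f = "(+)"] sum.cong) auto
  finally have "12 * (\<Sum>j<m. h j) =
     2 * (6 * (\<Sum>j<n. 2 * int k * int k + (int j * int j + (int j + 1) * int j)) +
      6 * (\<Sum>j<k. 2 * int n * int n + (int j * int j + (int j + 1) * int j)))"
    by simp
  also have "\<dots> =
     2 * (6 * int n * (2 * int k * int k) + int n * (int n - 1) * (4 * int n + 1) +
          (6 * int k * (2 * int n * int n) + int k * (int k - 1) * (4 * int k + 1)))"
    unfolding sum_alternating_squares ..
  also have "\<dots> = extremal_count m"
  proof (cases "even m")
    case True
    then have "k = n" by (auto simp: n_def k_def)
    then show ?thesis
      using True by (simp add: extremal_count_def m power2_eq_square power3_eq_cube algebra_simps)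
  next
    case False
    then have "k = Suc n" unfolding n_def k_def by presburger
    then show ?thesis
      using False by (simp add: extremal_count_def m power2_eq_square power3_eq_cube algebra_simps)
  qed
  finally show ?thesis unfolding S .
qed

section \<open>Pairs avoiding the apex in the alternating ordering\<close>

lemma sum_base_poly:
  "6 * (\<Sum>k<n. (M - int k) * (int k * int k) + (M - 1 - int k) * ((int k + 1) * int k)) =
    (2 * M - 2) * (int n * (int n - 1) * (2 * int n - 1)) - 3 * (int n * (int n - 1))\<^sup>2
      + 3 * (M - 1) * (int n * (int n - 1))"
  \<comment> \<open>\<open>M\<close> is independent of \<open>n\<close>, so the induction step adds
    a single term; the identity is used with \<open>n = m\<close> and
    \<open>M = int m\<close>.\<close>
  by (induction n) (auto simp: algebra_simps power2_eq_square)

lemma sum_if_le: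
  fixes c :: int
  shows "i < m \<Longrightarrow> (\<Sum>j<m. if i \<le> j then c else 0) = (int m - int i) * c"
    and "i < m \<Longrightarrow> (\<Sum>j<m. if j < i then c else 0) = int i * c"
    and "i < m \<Longrightarrow> (\<Sum>j<m. if j \<le> i then c else 0) = (int i + 1) * c"
    and "i < m \<Longrightarrow> (\<Sum>j<m. if i < j then c else 0) = (int m - 1 - int i) * c"
proof -
  assume i: "i < m"
  have "{..<m} \<inter> {j. i \<le> j} = {i..<m}" "{..<m} \<inter> {j. j < i} = {..<i}"
    "{..<m} \<inter> {j. j \<le> i} = {..i}" "{..<m} \<inter> {j. i < j} = {Suc i..<m}" using i by auto
  then show "(\<Sum>j<m. if i \<le> j then c else 0) = (int m - int i) * c"
    "(\<Sum>j<m. if j < i then c else 0) = int i * c"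
    "(\<Sum>j<m. if j \<le> i then c else 0) = (int i + 1) * c"
    "(\<Sum>j<m. if i < j then c else 0) = (int m - 1 - int i) * c"
    using i by (simp_all add: sum.If_cases of_nat_diff algebra_simps)
qed

text \<open>The comparison selects one index on which the summand depends, so each value is weighted
  by its number of partners. The half governed by the inner index is swapped outward first.\<close>

lemma sum_if_split:
  fixes X Y :: "nat \<Rightarrow> int"
  shows "(\<Sum>i<m. \<Sum>j<m. if i \<le> j then X i else Y j) =
    (\<Sum>i<m. (int m - int i) * X i + (int m - 1 - int i) * Y i)" (is ?A)
  and "(\<Sum>i<m. \<Sum>j<m. if i \<le> j then X j else Y i) =
    (\<Sum>i<m. (int i + 1) * X i + int i * Y i)" (is ?B)
proof -
  have 1: "(if i \<le> j then x else y) = (if i \<le> j then x else 0) + (if j < i then y else 0)"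
    for i j :: nat and x y :: int by auto
  have "(\<Sum>i<m. \<Sum>j<m. if i \<le> j then X i else Y j) =
    (\<Sum>i<m. \<Sum>j<m. if i \<le> j then X i else 0) + (\<Sum>j<m. \<Sum>i<m. if j < i then Y j else 0)"
    by (subst 1, subst (3) sum.swap) (simp add: sum.distrib)
  then show ?A by (simp add: sum_if_le sum.distrib)
  have "(\<Sum>i<m. \<Sum>j<m. if i \<le> j then X j else Y i) =
    (\<Sum>j<m. \<Sum>i<m. if i \<le> j then X j else 0) + (\<Sum>i<m. \<Sum>j<m. if j < i then Y i else 0)"
    by (subst 1, subst (2) sum.swap) (simp add: sum.distrib)
  then show ?B by (simp add: sum_if_le sum.distrib)
qed

text \<open>The reversed alternating word is alternating with the parts exchanged, so edges beyond
  and edges before give the same sum \<open>P\<close>; the two orientations in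
  \<open>base_quads\<close> double it.\<close>

lemma card_base_quads_sep_alt_pos:
  "3 * int (card {q \<in> base_quads m. quad_sep (alt_pos m) q}) =
    2 * (int m * (int m - 1)\<^sup>2 * (int m + 1))"
proof -
  let ?A = "tripart m 1" and ?B = "tripart m 2" and ?f = "alt_pos m"
  let ?U = "cross_above ?f ?A ?B" and ?D = "cross_above (\<lambda>v. - ?f v) ?A ?B"
  define P where "P = (\<Sum>k<m. (int m - int k) * (int k * int k) + (int m - 1 - int k) * ((int k + 1) * int k))"
  have ap: "?f (1, j) = 4 * int j + 1" "?f (2, j) = 4 * int j + 2" for j
    by (auto simp: alt_pos_def)
  have S: "int (card {q \<in> base_quads m. quad_sep ?f q}) =
    2 * ((\<Sum>i<m. \<Sum>j<m. ?U (max (4 * int i + 1) (4 * int j + 2))) +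
         (\<Sum>i<m. \<Sum>j<m. ?D (max (- (4 * int i + 1)) (- (4 * int j + 2)))))"
  proof -
    have s: "(\<Sum>(b, a)\<in>?B \<times> ?A. cross_above ?f ?B ?A (max (?f b) (?f a)) +
                  cross_above (\<lambda>v. - ?f v) ?B ?A (max (- ?f b) (- ?f a))) =
        (\<Sum>(a, b)\<in>?A \<times> ?B. ?U (max (?f a) (?f b)) + ?D (max (- ?f a) (- ?f b)))"
      by (subst (1 2) sum.cartesian_product[symmetric], subst sum.swap)
         (simp add: cross_above_commute[of _ ?B ?A] max.commute)
    have "int (card {q \<in> base_quads m. quad_sep ?f q}) =
       2 * (\<Sum>(a, b)\<in>?A \<times> ?B. ?U (max (?f a) (?f b)) + ?D (max (- ?f a) (- ?f b)))"
      unfolding base_quads_def using s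
      by (subst card_filter_quads_Un) (simp_all add: tripart_disjoint card_quad_sep)
    then show ?thesis
      by (simp add: sum.cartesian_product[symmetric] sum_tripart ap sum.distrib)
  qed
  have "(\<Sum>i<m. \<Sum>j<m. ?U (max (4 * int i + 1) (4 * int j + 2))) =
    (\<Sum>i<m. \<Sum>j<m. if i \<le> j then (int m - 1 - int j) * (int m - 1 - int j)
                   else (int m - 1 - int i) * (int m - int i))"
  proof (intro sum.cong refl)
    fix i j assume "i \<in> {..<m}" "j \<in> {..<m}"
    moreover have "max (4 * int i + 1) (4 * int j + 2) = (if i \<le> j then 4 * int j + 2 else 4 * int i + 1)"
      by auto
    ultimately show "?U (max (4 * int i + 1) (4 * int j + 2)) =
        (if i \<le> j then (int m - 1 - int j) * (int m - 1 - int j)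
                   else (int m - 1 - int i) * (int m - int i))"
      by (simp add: cross_above_alt_pos)
  qed
  also have "\<dots> = (\<Sum>i<m. (int i + 1) * ((int m - 1 - int i) * (int m - 1 - int i))
      + int i * ((int m - 1 - int i) * (int m - int i)))"
    by (rule sum_if_split(2)[where X = "\<lambda>j. (int m - 1 - int j) * (int m - 1 - int j)"
          and Y = "\<lambda>i. (int m - 1 - int i) * (int m - int i)"])
  also have "\<dots> = P"
    unfolding P_def
    \<comment> \<open>The substitution of \<open>m - 1 - i\<close> for \<open>i\<close> is the
      reversal of the word.\<close>
    by (subst sum.nat_diff_reindex[symmetric]) (auto intro!: sum.cong simp: of_nat_diff algebra_simps)
  finally have U: "(\<Sum>i<m. \<Sum>j<m. ?U (max (4 * int i + 1) (4 * int j + 2))) = P" .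
  have "(\<Sum>i<m. \<Sum>j<m. ?D (max (- (4 * int i + 1)) (- (4 * int j + 2)))) =
    (\<Sum>i<m. \<Sum>j<m. if i \<le> j then int i * int i else (int j + 1) * int j)"
  proof (intro sum.cong refl)
    fix i j assume "i \<in> {..<m}" "j \<in> {..<m}"
    moreover have "max (- (4 * int i + 1)) (- (4 * int j + 2)) =
        (if i \<le> j then - (4 * int i + 1) else - (4 * int j + 2))"
      by auto
    ultimately show "?D (max (- (4 * int i + 1)) (- (4 * int j + 2))) =
        (if i \<le> j then int i * int i else (int j + 1) * int j)"
      by (simp only: cross_below_alt_pos lessThan_iff split: if_split) auto
  qed
  also have "\<dots> = P"
    unfolding P_def by (rule sum_if_split(1))
  finally have D: "(\<Sum>i<m. \<Sum>j<m. ?D (max (- (4 * int i + 1)) (- (4 * int j + 2)))) = P" .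
  have "6 * P = int m * (int m - 1)\<^sup>2 * (int m + 1)"
    unfolding P_def sum_base_poly by (simp add: algebra_simps power2_eq_square)
  then show ?thesis unfolding S U D by simp
qed

section \<open>Averaging over automorphisms\<close>

text \<open>Double counting of the \<open>(g, p)\<close> with \<open>Q (act g p)\<close>: by
  transitivity every \<open>p\<close> has the same number of \<open>g\<close>, and as each
  \<open>act g\<close> permutes \<open>P\<close>, every \<open>g\<close> has the same number of
  \<open>p\<close>.\<close>

lemma card_transitive_average:
  fixes G :: "('a \<Rightarrow> 'a) set" and act :: "('a \<Rightarrow> 'a) \<Rightarrow> 'b \<Rightarrow> 'b"
  assumes fin: "finite G" "finite P"
    and G: "\<And>g h. g \<in> G \<Longrightarrow> h \<in> G \<Longrightarrow> g \<circ> h \<in> G" "\<And>g. g \<in> G \<Longrightarrow> surj g"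
    and act: "\<And>g p. g \<in> G \<Longrightarrow> p \<in> P \<Longrightarrow> act g p \<in> P" "\<And>g. g \<in> G \<Longrightarrow> inj_on (act g) P"
      "\<And>g h p. act (g \<circ> h) p = act g (act h p)"
    and trans: "\<And>p p'. p \<in> P \<Longrightarrow> p' \<in> P \<Longrightarrow> \<exists>h\<in>G. act h p = p'"
    and p: "p \<in> P"
  shows "card {g \<in> G. Q (act g p)} * card P = card G * card {p \<in> P. Q p}"
proof -
  have const: "card {g \<in> G. Q (act g p')} = card {g \<in> G. Q (act g p)}" if p': "p' \<in> P" for p'
  proof -
    obtain h where h: "h \<in> G" "act h p = p'" using trans[OF p p'] by blast
    \<comment> \<open>Surjectivity of \<open>h\<close> makes right composition with \<open>h\<close>
      injective; finiteness of \<open>G\<close> then makes it a permutation of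
      \<open>G\<close>.\<close>
    have inj: "inj_on (\<lambda>g. g \<circ> h) G"
      using G(2)[OF h(1)] by (intro inj_onI) (metis (no_types, lifting) ext comp_apply surjD)
    have "(\<lambda>g. g \<circ> h) ` G = G"
      using inj fin(1) G(1)[OF _ h(1)] by (intro endo_inj_surj) auto
    moreover have "act (g \<circ> h) p = act g p'" for g
      by (simp only: act(3) h(2))
    ultimately have "{g \<in> G. Q (act g p)} = (\<lambda>g. g \<circ> h) ` {g \<in> G. Q (act g p')}"
      by (smt (verit) Collect_cong image_Collect image_iff mem_Collect_eq set_eqI)
    moreover have "inj_on (\<lambda>g. g \<circ> h) {g \<in> G. Q (act g p')}"
      using inj by (rule inj_on_subset) auto
    ultimately show ?thesis by (simp add: card_image)
  qed
  have orb: "card {p \<in> P. Q (act g p)} = card {p \<in> P. Q p}" if g: "g \<in> G" for g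
  proof -
    have "act g ` P = P" using act(1,2)[OF g] fin(2) by (intro endo_inj_surj) auto
    then have "bij_betw (act g) {p \<in> P. Q (act g p)} {p \<in> P. Q p}"
      using act(2)[OF g] by (auto simp: bij_betw_def inj_on_def)
    then show ?thesis by (rule bij_betw_same_card)
  qed
  have "card {g \<in> G. Q (act g p)} * card P = (\<Sum>p'\<in>P. card {g \<in> G. Q (act g p')})"
    using const by simp
  also have "\<dots> = (\<Sum>p'\<in>P. \<Sum>g\<in>G. if Q (act g p') then 1 else 0)"
    using fin by (simp add: sum.If_cases Int_def)
  also have "\<dots> = (\<Sum>g\<in>G. \<Sum>p'\<in>P. if Q (act g p') then 1 else 0)"
    by (rule sum.swap)
  also have "\<dots> = (\<Sum>g\<in>G. card {p \<in> P. Q (act g p)})"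
    using fin by (simp add: sum.If_cases Int_def)
  also have "\<dots> = card G * card {p \<in> P. Q p}"
    using orb by simp
  finally show ?thesis .
qed

text \<open>Adjacency means different part indices, so these are the graph automorphisms fixing the
  apex; being the identity off \<open>verts m\<close> makes the set finite.\<close>

definition auts :: "nat \<Rightarrow> (nat \<times> nat \<Rightarrow> nat \<times> nat) set" where
  "auts m = {g. g permutes verts m \<and> g apex = apex \<and>
     (\<forall>u\<in>verts m. \<forall>v\<in>verts m. fst (g u) = fst (g v) \<longleftrightarrow> fst u = fst v)}"

definition quad_map :: "('a \<Rightarrow> 'a) \<Rightarrow> ('a \<times> 'a) \<times> ('a \<times> 'a) \<Rightarrow> ('a \<times> 'a) \<times> ('a \<times> 'a)" where
  "quad_map g = map_prod (map_prod g g) (map_prod g g)"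

lemma quad_map_simp [simp]: "quad_map g ((a, b), (c, d)) = ((g a, g b), (g c, g d))"
  by (simp add: quad_map_def)

text \<open>Only the apex and equality of parts are mentioned, which is exactly what
  \<open>auts\<close> preserves.\<close>

lemma mem_apex_quads_iff:
  "((a, b), (c, d)) \<in> apex_quads m \<longleftrightarrow>
    a = apex \<and> {b, c, d} \<subseteq> verts m - {apex} \<and> fst b = fst c \<and> fst d \<noteq> fst b \<and> b \<noteq> c"
  by (auto simp: apex_quads_def quads_def verts_def mem_tripart_iff apex_def)

lemma mem_base_quads_iff:
  "((a, b), (c, d)) \<in> base_quads m \<longleftrightarrow>
    {a, b, c, d} \<subseteq> verts m - {apex} \<and> fst a = fst c \<and> fst b = fst d \<and> fst a \<noteq> fst b
      \<and> a \<noteq> c \<and> b \<noteq> d"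
  by (auto simp: base_quads_def quads_def verts_def mem_tripart_iff apex_def)

lemma finite_auts [simp]: "finite (auts m)"
  by (rule finite_subset[OF _ finite_permutations[of "verts m"]]) (auto simp: auts_def)

lemma auts_compose: "g \<in> auts m \<Longrightarrow> h \<in> auts m \<Longrightarrow> g \<circ> h \<in> auts m"
  by (auto simp: auts_def permutes_compose permutes_in_image)

lemma auts_bij: "g \<in> auts m \<Longrightarrow> bij g"
  by (auto simp: auts_def permutes_bij)

lemma auts_image:
  assumes "g \<in> auts m"
  shows "g v \<in> verts m \<longleftrightarrow> v \<in> verts m" and "g v = apex \<longleftrightarrow> v = apex"
proof -
  show "g v \<in> verts m \<longleftrightarrow> v \<in> verts m" using assms by (simp add: auts_def permutes_in_image)
  have "g apex = apex" using assms by (simp add: auts_def)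
  then show "g v = apex \<longleftrightarrow> v = apex" using bij_is_inj[OF auts_bij[OF assms]] by (metis injD)
qed

lemma auts_fst:
  "g \<in> auts m \<Longrightarrow> u \<in> verts m \<Longrightarrow> v \<in> verts m \<Longrightarrow> fst (g u) = fst (g v) \<longleftrightarrow> fst u = fst v"
  by (simp add: auts_def)

lemma auts_eq_iff: "g \<in> auts m \<Longrightarrow> g u = g v \<longleftrightarrow> u = v"
  using bij_is_inj[OF auts_bij] by (metis injD)

lemma quad_map_apex_quads: "g \<in> auts m \<Longrightarrow> q \<in> apex_quads m \<Longrightarrow> quad_map g q \<in> apex_quads m"
  by (cases q rule: prod.exhaust[case_product prod.exhaust prod.exhaust])
     (auto simp: mem_apex_quads_iff auts_image auts_fst auts_eq_iff)

lemma quad_map_base_quads: "g \<in> auts m \<Longrightarrow> q \<in> base_quads m \<Longrightarrow> quad_map g q \<in> base_quads m"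
  by (cases q rule: prod.exhaust[case_product prod.exhaust prod.exhaust])
     (auto simp: mem_base_quads_iff auts_image auts_fst auts_eq_iff)

text \<open>One transposition takes \<open>u\<close> to \<open>u'\<close>; a second takes the image
  of \<open>v\<close> to \<open>v'\<close>. For \<open>u \<noteq> v\<close> the second one fixes
  \<open>u'\<close>, and otherwise it is trivial.\<close>

lemma permutes_two_points:
  assumes "u \<in> S" "v \<in> S" "u' \<in> S" "v' \<in> S" "u = v \<longleftrightarrow> u' = v'"
  shows "\<exists>\<sigma>. \<sigma> permutes S \<and> \<sigma> u = u' \<and> \<sigma> v = v'"
proof -
  let ?t = "Transposition.transpose u u'"
  have t: "?t permutes S" using assms by (intro permutes_swap_id)
  then have "?t v \<in> S" using assms by (simp add: permutes_in_image)
  then have "Transposition.transpose (?t v) v' permutes S" using assms by (intro permutes_swap_id)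
  then have "(Transposition.transpose (?t v) v' \<circ> ?t) permutes S" using t by (rule permutes_compose[rotated])
  moreover have "(Transposition.transpose (?t v) v' \<circ> ?t) u = u'" "(Transposition.transpose (?t v) v' \<circ> ?t) v = v'"
    using assms(5) by (auto simp: Transposition.transpose_def)
  ultimately show ?thesis by blast
qed

lemma tripart_permutation_in_auts:
  assumes "\<sigma> permutes tripart m i" "i = 1 \<or> i = 2"
  shows "\<sigma> \<in> auts m"
proof -
  have "fst (\<sigma> v) = fst v" for v
    using assms(1) permutes_in_image[OF assms(1), of v]
    by (cases "v \<in> tripart m i") (auto simp: mem_tripart_iff permutes_not_in)
  moreover have "\<sigma> permutes verts m"
    by (rule permutes_subset[OF assms(1)]) (use assms(2) in \<open>auto simp: verts_def\<close>)
  moreover have "\<sigma> apex = apex"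
    using assms by (intro permutes_not_in[OF assms(1)] apex_notin_tripart) auto
  ultimately show ?thesis by (simp add: auts_def)
qed

definition swap_parts :: "nat \<Rightarrow> nat \<times> nat \<Rightarrow> nat \<times> nat" where
  "swap_parts m v = (if v \<in> verts m - {apex} then (3 - fst v, snd v) else v)"

lemma swap_parts_tripart:
  "i = 1 \<or> i = 2 \<Longrightarrow> v \<in> tripart m i \<Longrightarrow> swap_parts m v \<in> tripart m (3 - i)"
  by (auto simp: swap_parts_def verts_def mem_tripart_iff apex_def)

lemma swap_parts_in_auts: "swap_parts m \<in> auts m"
proof -
  have "bij_betw (swap_parts m) (verts m) (verts m)"
    by (rule bij_betw_byWitness[where f' = "swap_parts m"])
       (auto simp: swap_parts_def verts_def mem_tripart_iff apex_def)
  then have "swap_parts m permutes verts m"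
    by (rule bij_imp_permutes) (simp add: swap_parts_def)
  then show ?thesis
    by (auto simp: auts_def swap_parts_def verts_def mem_tripart_iff apex_def)
qed

lemma auts_move_same:
  assumes ij: "(i, j) = (1, 2) \<or> (i, j) = (2, 1)"
    and in1: "{a, c, a', c'} \<subseteq> tripart m i" "a = c \<longleftrightarrow> a' = c'"
    and in2: "{b, d, b', d'} \<subseteq> tripart m j" "b = d \<longleftrightarrow> b' = d'"
  shows "\<exists>h\<in>auts m. h a = a' \<and> h b = b' \<and> h c = c' \<and> h d = d'"
proof -
  obtain \<sigma> where s: "\<sigma> permutes tripart m i" "\<sigma> a = a'" "\<sigma> c = c'"
    using permutes_two_points[of a "tripart m i" c a' c'] in1 by auto
  obtain \<tau> where t: "\<tau> permutes tripart m j" "\<tau> b = b'" "\<tau> d = d'"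
    using permutes_two_points[of b "tripart m j" d b' d'] in2 by auto
  have dis: "tripart m i \<inter> tripart m j = {}" using ij by (intro tripart_disjoint) auto
  have "\<tau> a = a" "\<tau> c = c" using dis in1 by (auto intro!: permutes_not_in[OF t(1)])
  moreover have "\<sigma> b' = b'" "\<sigma> d' = d'" using dis in2 by (auto intro!: permutes_not_in[OF s(1)])
  moreover have "\<sigma> \<circ> \<tau> \<in> auts m"
    using ij s(1) t(1) by (intro auts_compose tripart_permutation_in_auts) auto
  ultimately show ?thesis using s t by (intro bexI[of _ "\<sigma> \<circ> \<tau>"]) auto
qed

text \<open>One permutation in each part moves all four vertices; if source and target orientations
  differ, the parts are exchanged first.\<close>

lemma auts_move:
  assumes ij: "(i, j) = (1, 2) \<or> (i, j) = (2, 1)" "(i', j') = (1, 2) \<or> (i', j') = (2, 1)"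
    and in1: "{a, c} \<subseteq> tripart m i" "{a', c'} \<subseteq> tripart m i'" "a = c \<longleftrightarrow> a' = c'"
    and in2: "{b, d} \<subseteq> tripart m j" "{b', d'} \<subseteq> tripart m j'" "b = d \<longleftrightarrow> b' = d'"
  shows "\<exists>h\<in>auts m. h a = a' \<and> h b = b' \<and> h c = c' \<and> h d = d'"
proof (cases "i = i'")
  case True
  then have "j = j'" using ij by auto
  then show ?thesis using auts_move_same[of i j a c a' c' m b d b' d'] True assms by auto
next
  case False
  let ?s = "swap_parts m"
  have "i' = 3 - i" "j' = 3 - j" using False ij by auto
  then have "?s a \<in> tripart m i'" "?s c \<in> tripart m i'" "?s b \<in> tripart m j'" "?s d \<in> tripart m j'"
    using ij in1(1) in2(1) by (auto intro!: swap_parts_tripart)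
  then have "\<exists>h\<in>auts m. h (?s a) = a' \<and> h (?s b) = b' \<and> h (?s c) = c' \<and> h (?s d) = d'"
    using in1 in2
    by (intro auts_move_same[OF ij(2)]) (simp_all add: auts_eq_iff[OF swap_parts_in_auts])
  then obtain h where "h \<in> auts m" "h (?s a) = a' \<and> h (?s b) = b' \<and> h (?s c) = c' \<and> h (?s d) = d'"
    by blast
  then show ?thesis
    using auts_compose[OF _ swap_parts_in_auts] by (intro bexI[of _ "h \<circ> ?s"]) auto
qed

lemma verts_tripart:
  "v \<in> verts m - {apex} \<Longrightarrow> v \<in> tripart m (fst v) \<and> (fst v = 1 \<or> fst v = 2)"
  by (auto simp: verts_def mem_tripart_iff)

lemma base_quads_transitive:
  assumes "q \<in> base_quads m" "q' \<in> base_quads m"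
  shows "\<exists>h\<in>auts m. quad_map h q = q'"
proof -
  obtain a b c d where q: "q = ((a, b), (c, d))" by (metis surj_pair)
  obtain a' b' c' d' where q': "q' = ((a', b'), (c', d'))" by (metis surj_pair)
  have "\<exists>h\<in>auts m. h a = a' \<and> h b = b' \<and> h c = c' \<and> h d = d'"
    using assms verts_tripart[of a m] verts_tripart[of b m] verts_tripart[of c m] verts_tripart[of d m]
      verts_tripart[of a' m] verts_tripart[of b' m] verts_tripart[of c' m] verts_tripart[of d' m]
    unfolding q q' mem_base_quads_iff
    by (intro auts_move[of "fst a" "fst b" "fst a'" "fst b'"]) auto
  then show ?thesis by (auto simp: q q')
qed

lemma apex_quads_transitive:
  assumes "q \<in> apex_quads m" "q' \<in> apex_quads m"
  shows "\<exists>h\<in>auts m. quad_map h q = q'"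
proof -
  obtain b c d where q: "q = ((apex, b), (c, d))" 
    using assms(1) by (metis mem_apex_quads_iff surj_pair)
  obtain b' c' d' where q': "q' = ((apex, b'), (c', d'))"
    using assms(2) by (metis mem_apex_quads_iff surj_pair)
  \<comment> \<open>Only one vertex lies in the part opposite to \<open>b\<close>, so
    \<open>d\<close> fills both places there.\<close>
  have "\<exists>h\<in>auts m. h b = b' \<and> h d = d' \<and> h c = c' \<and> h d = d'"
    using assms verts_tripart[of b m] verts_tripart[of c m] verts_tripart[of d m]
      verts_tripart[of b' m] verts_tripart[of c' m] verts_tripart[of d' m]
    unfolding q q' mem_apex_quads_iff
    by (intro auts_move[of "fst b" "fst d" "fst b'" "fst d'"]) auto
  then show ?thesis by (auto simp: q q' auts_def)
qed

lemma quad_map_comp: "quad_map (g \<circ> h) q = quad_map g (quad_map h q)"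
  by (simp add: quad_map_def map_prod_compose[symmetric] prod.map_comp)

lemma inj_on_quad_map: "inj g \<Longrightarrow> inj_on (quad_map g) P"
  by (rule inj_on_subset[of _ UNIV]) (auto simp: quad_map_def intro!: prod.inj_map)

lemma card_auts_apex:
  "q \<in> apex_quads m \<Longrightarrow> card {g \<in> auts m. Q (quad_map g q)} * card (apex_quads m)
      = card (auts m) * card {q \<in> apex_quads m. Q q}"
  by (rule card_transitive_average[OF finite_auts finite_apex_quads auts_compose
        bij_is_surj[OF auts_bij] quad_map_apex_quads inj_on_quad_map[OF bij_is_inj[OF auts_bij]]
        quad_map_comp apex_quads_transitive])

lemma card_auts_base:
  "q \<in> base_quads m \<Longrightarrow> card {g \<in> auts m. Q (quad_map g q)} * card (base_quads m)
      = card (auts m) * card {q \<in> base_quads m. Q q}"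
  by (rule card_transitive_average[OF finite_auts finite_base_quads auts_compose
        bij_is_surj[OF auts_bij] quad_map_base_quads inj_on_quad_map[OF bij_is_inj[OF auts_bij]]
        quad_map_comp base_quads_transitive])

section \<open>The fractional separation dimension\<close>

text \<open>The inequality for every list gives \<open>C\<close> as a lower bound of the liminf.
  Repeating the optimal list \<open>k\<close> times keeps the quotient at most \<open>C\<close>
  along the multiples of \<open>T\<close>, and the liminf is at most that of a subsequence.\<close>

lemma frac_sep_dim_eqI:
  fixes C :: real
  assumes T: "0 < T" and rs: "separating_list V E T rs" "C * real T = real (length rs)"
    and lower: "\<And>t rs. separating_list V E t rs \<Longrightarrow> C * real t \<le> real (length rs)"
  shows "frac_sep_dim V E = ereal C"
proof -
  have rep: "length (filter P (concat (replicate k rs))) = k * length (filter P rs)" for P k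
    by (induction k) auto
  have mult: "separating_list V E (k * T) (concat (replicate k rs))" for k
    using rs(1) by (auto simp: separating_list_def rep intro!: mult_le_mono2)
  have "\<exists>n rs. separating_list V E t rs \<and> length rs = n" for t
  proof -
    have "t \<le> t * T" using T by simp
    then have "separating_list V E t (concat (replicate t rs))"
      using mult[of t] unfolding separating_list_def by (meson le_trans)
    then show ?thesis by blast
  qed
  then have att: "\<exists>rs. separating_list V E t rs \<and> length rs = sep_dim t V E" for t
    unfolding sep_dim_def by (rule LeastI_ex)
  have "ereal C \<le> frac_sep_dim V E"
    unfolding frac_sep_dim_def
  proof (rule Liminf_bounded)
    show "\<forall>\<^sub>F t in sequentially. ereal C \<le> ereal (real (sep_dim t V E) / real t)"
      using eventually_gt_at_top[of 0]
    proof eventually_elim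
      case (elim t)
      have "C * real t \<le> real (sep_dim t V E)" using att[of t] lower by metis
      then show ?case using elim by (simp add: field_simps)
    qed
  qed
  moreover have "frac_sep_dim V E \<le> ereal C"
  proof -
    \<comment> \<open>\<open>Suc k\<close> keeps \<open>s k\<close> positive, away from the default
      value of division by zero.\<close>
    define s where "s k = Suc k * T" for k
    have s: "strict_mono s" using T by (auto simp: strict_mono_Suc_iff s_def)
    let ?X = "\<lambda>t. ereal (real (sep_dim t V E) / real t)"
    have "?X (s k) \<le> ereal C" for k
    proof -
      have "sep_dim (s k) V E \<le> length (concat (replicate (Suc k) rs))"
        unfolding sep_dim_def s_def by (rule Least_le) (use mult in blast)
      also have "\<dots> = Suc k * length rs" using rep[of "\<lambda>_. True" "Suc k"] by simp
      finally have "real (sep_dim (s k) V E) \<le> real (Suc k) * real (length rs)"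
        by (metis of_nat_le_iff of_nat_mult)
      also have "\<dots> = C * real (s k)" by (simp add: s_def algebra_simps flip: rs(2))
      finally have "real (sep_dim (s k) V E) \<le> C * real (s k)" .
      moreover have "s k > 0" using T by (simp add: s_def)
      ultimately show ?thesis by (simp add: pos_divide_le_eq)
    qed
    then have "liminf (?X \<circ> s) \<le> liminf (\<lambda>k. ereal C)"
      by (intro Liminf_mono) auto
    then show ?thesis
      using liminf_subseq_mono[OF s, of ?X] unfolding frac_sep_dim_def
      by (simp add: Liminf_const)
  qed
  ultimately show ?thesis by (rule antisym[rotated])
qed

section \<open>Edge pairs as quadruples\<close>

lemma edges_eq:
  "multipartite_edges [1, m, m] = {{u, v} | u v. u \<in> verts m \<and> v \<in> verts m \<and> fst u \<noteq> fst v}"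
  by (simp add: multipartite_edges_def verts_eq)

lemma edgeI:
  "u \<in> verts m \<Longrightarrow> v \<in> verts m \<Longrightarrow> fst u \<noteq> fst v \<Longrightarrow> {u, v} \<in> multipartite_edges [1, m, m]"
  unfolding edges_eq by blast

lemma quads_edges:
  assumes "((a, b), (c, d)) \<in> apex_quads m \<union> base_quads m"
  shows "{a, b} \<in> multipartite_edges [1, m, m]" "{c, d} \<in> multipartite_edges [1, m, m]"
    "{a, b} \<inter> {c, d} = {}" "{a, b, c, d} \<subseteq> verts m"
proof -
  have "apex \<in> verts m" by (simp add: verts_def)
  moreover have "fst apex = 0" by (simp add: apex_def)
  ultimately have *: "{a, b, c, d} \<subseteq> verts m \<and> fst a \<noteq> fst b \<and> fst c \<noteq> fst d \<and>
      a \<noteq> c \<and> a \<noteq> d \<and> b \<noteq> c \<and> b \<noteq> d"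
    using assms verts_tripart[of b m] verts_tripart[of c m] verts_tripart[of d m]
    by (auto simp: mem_apex_quads_iff mem_base_quads_iff)
  then show "{a, b} \<in> multipartite_edges [1, m, m]" "{c, d} \<in> multipartite_edges [1, m, m]"
    by (auto intro!: edgeI)
  show "{a, b} \<inter> {c, d} = {}" "{a, b, c, d} \<subseteq> verts m"
    using * by auto
qed

text \<open>At most one of the two edges contains the apex. All other endpoints lie in the two large
  parts, one of each for an edge avoiding the apex, so reordering endpoints makes the parts
  match.\<close>

lemma edges_quads:
  assumes "e \<in> multipartite_edges [1, m, m]" "f \<in> multipartite_edges [1, m, m]" "nonincident e f"
  obtains a b c d where "((a, b), (c, d)) \<in> apex_quads m \<union> base_quads m"
    "e = {a, b} \<and> f = {c, d} \<or> f = {a, b} \<and> e = {c, d}"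
proof -
  obtain u v where e: "e = {u, v}" "u \<in> verts m" "v \<in> verts m" "fst u \<noteq> fst v"
    using assms(1) unfolding edges_eq by blast
  obtain u' v' where f: "f = {u', v'}" "u' \<in> verts m" "v' \<in> verts m" "fst u' \<noteq> fst v'"
    using assms(2) unfolding edges_eq by blast
  have dis: "u \<noteq> u'" "u \<noteq> v'" "v \<noteq> u'" "v \<noteq> v'"
    using assms(3) e f by (auto simp: nonincident_def)
  have part: "fst w = 1 \<or> fst w = 2" if "w \<in> verts m" "w \<noteq> apex" for w
    using verts_tripart[of w m] that by auto
  have apex_case: "\<exists>c d. ((apex, w), (c, d)) \<in> apex_quads m \<and> {x, y} = {c, d}"
    if "w \<in> verts m" "w \<noteq> apex" "x \<in> verts m" "y \<in> verts m" "x \<noteq> apex" "y \<noteq> apex"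
      "fst x \<noteq> fst y" "w \<noteq> x" "w \<noteq> y" for w x y
  proof (cases "fst w = fst x")
    case True
    then have "((apex, w), (x, y)) \<in> apex_quads m" using that by (auto simp: mem_apex_quads_iff)
    then show ?thesis by blast
  next
    case False
    then have "fst w = fst y" using part[of w] part[of x] part[of y] that by auto
    then have "((apex, w), (y, x)) \<in> apex_quads m" using that by (auto simp: mem_apex_quads_iff)
    then show ?thesis by blast
  qed
  have "\<exists>a b c d. ((a, b), (c, d)) \<in> apex_quads m \<union> base_quads m \<and>
    (e = {a, b} \<and> f = {c, d} \<or> f = {a, b} \<and> e = {c, d})"
  proof -
    consider "u = apex" | "v = apex" | "u' = apex" | "v' = apex"
      | "u \<noteq> apex" "v \<noteq> apex" "u' \<noteq> apex" "v' \<noteq> apex" by blast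
    then show ?thesis
    proof cases
      case 1
      then have "e = {apex, v}" using e by auto
      moreover have "\<exists>c d. ((apex, v), (c, d)) \<in> apex_quads m \<and> {u', v'} = {c, d}"
        using 1 e f dis by (intro apex_case) auto
      ultimately show ?thesis using f(1) by blast
    next
      case 2
      then have "e = {apex, u}" using e by auto
      moreover have "\<exists>c d. ((apex, u), (c, d)) \<in> apex_quads m \<and> {u', v'} = {c, d}"
        using 2 e f dis by (intro apex_case) auto
      ultimately show ?thesis using f(1) by blast
    next
      case 3
      then have "f = {apex, v'}" using f by auto
      moreover have "\<exists>c d. ((apex, v'), (c, d)) \<in> apex_quads m \<and> {u, v} = {c, d}"
        using 3 e f dis by (intro apex_case) auto
      ultimately show ?thesis using e(1) by blast
    next
      case 4
      then have "f = {apex, u'}" using f by auto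
      moreover have "\<exists>c d. ((apex, u'), (c, d)) \<in> apex_quads m \<and> {u, v} = {c, d}"
        using 4 e f dis by (intro apex_case) auto
      ultimately show ?thesis using e(1) by blast
    next
      case 5
      show ?thesis
      proof (cases "fst u = fst u'")
        case True
        then have "fst v = fst v'" using part[of u] part[of v] part[of u'] part[of v'] 5 e f by auto
        then have "((u, v), (u', v')) \<in> base_quads m"
          using True 5 e f dis by (auto simp: mem_base_quads_iff)
        then show ?thesis using e f by blast
      next
        case False
        then have "fst u = fst v'" "fst v = fst u'"
          using part[of u] part[of v] part[of u'] part[of v'] 5 e f by auto
        then have "((u, v), (v', u')) \<in> base_quads m"
          using 5 e f dis by (auto simp: mem_base_quads_iff)
        moreover have "f = {v', u'}" using f by auto
        ultimately show ?thesis using e by blast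
      qed
    qed
  qed
  then show ?thesis using that by blast
qed

section \<open>The length bound and an optimal list\<close>

lemma separates_commute: "separates r e f \<longleftrightarrow> separates r f e"
  by (auto simp: separates_def)

text \<open>Double counting of separations of apex pairs: each pair gets at least \<open>t\<close>,
  and each ordering supplies at most \<open>extremal_count m / 12\<close>.\<close>

lemma separating_list_length_ge:
  assumes "separating_list (verts m) (multipartite_edges [1, m, m]) t rs" "1 \<le> m"
  shows "12 * int (card (apex_quads m)) * int t \<le> int (length rs) * extremal_count m"
proof -
  let ?s = "\<lambda>r q. separates r {fst (fst q), snd (fst q)} {fst (snd q), snd (snd q)}"
  let ?P = "apex_quads m"
  have bound: "12 * int (card {q \<in> ?P. ?s r q}) \<le> extremal_count m"
    if lin: "linear_order_on (verts m) r" for r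
  proof -
    obtain f where f: "inj_on f (verts m)" "r = order_of (verts m) f"
      using linear_order_on_eq_order_of[OF finite_verts lin] by blast
    have "?s r q \<longleftrightarrow> quad_sep f q" if "q \<in> ?P" for q
    proof -
      obtain a b c d where q: "q = ((a, b), (c, d))" by (metis surj_pair)
      show ?thesis
        using quads_edges[of a b c d m] that separates_order_of[OF f(1), of a b c d]
        unfolding q f(2) by simp
    qed
    then have "{q \<in> ?P. ?s r q} = {q \<in> ?P. quad_sep f q}" by blast
    then show ?thesis using card_apex_quads_sep_le[OF f(1) assms(2)] by simp
  qed
  have count: "12 * (\<Sum>q\<in>?P. int (length (filter (\<lambda>r. ?s r q) rs))) \<le> int (length rs) * extremal_count m"
    if "\<forall>r\<in>set rs. linear_order_on (verts m) r" for rs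
    using that
  proof (induction rs)
    case (Cons r rs)
    have "(\<Sum>q\<in>?P. int (length (filter (\<lambda>r. ?s r q) (r # rs)))) =
      (\<Sum>q\<in>?P. if ?s r q then 1 else 0) + (\<Sum>q\<in>?P. int (length (filter (\<lambda>r. ?s r q) rs)))"
      unfolding sum.distrib[symmetric] by (intro sum.cong) auto
    also have "(\<Sum>q\<in>?P. if ?s r q then 1 else 0) = int (card {q \<in> ?P. ?s r q})"
      by (simp add: sum.If_cases Int_def)
    finally show ?case using Cons bound[of r] by (simp add: algebra_simps)
  qed simp
  have "int t \<le> int (length (filter (\<lambda>r. ?s r q) rs))" if "q \<in> ?P" for q
  proof -
    obtain a b c d where q: "q = ((a, b), (c, d))" by (metis surj_pair)
    show ?thesis
      using quads_edges[of a b c d m] that assms(1)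
      unfolding q separating_list_def nonincident_def by simp
  qed
  then have "(\<Sum>q\<in>?P. int t) \<le> (\<Sum>q\<in>?P. int (length (filter (\<lambda>r. ?s r q) rs)))"
    by (rule sum_mono)
  then show ?thesis using count[of rs] assms(1) by (simp add: separating_list_def)
qed

text \<open>The list has one copy of the alternating ordering for each automorphism, and
  \<open>T\<close> is the common number of times an apex pair is separated.\<close>

lemma exists_optimal_separating_list:
  assumes "2 \<le> m"
  shows "\<exists>T rs. 0 < T \<and> separating_list (verts m) (multipartite_edges [1, m, m]) T rs \<and>
    12 * int (card (apex_quads m)) * int T = int (length rs) * extremal_count m"
proof -
  let ?G = "auts m" and ?A = "apex_quads m" and ?B = "base_quads m" and ?f = "alt_pos m"
  define cnt where "cnt q = card {g \<in> ?G. quad_sep ?f (quad_map g q)}" for q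
  define M where "M = int m"
  have M: "M \<ge> 2" using assms by (simp add: M_def)
  have cA: "int (card ?A) = 2 * (M * M * (M - 1))"
    using assms by (simp add: card_apex_quads M_def of_nat_diff)
  have cB: "int (card ?B) = 2 * (M * (M - 1))\<^sup>2"
    using assms by (simp add: card_base_quads M_def of_nat_diff)
  have "card ?A > 0" using cA M by (metis of_nat_0_less_iff mult_pos_pos zero_less_numeral diff_gt_0_iff_gt less_le_trans one_less_numeral_iff semiring_norm(76))
  then obtain q0 where q0: "q0 \<in> ?A" by (metis card.empty ex_in_conv less_numeral_extra(3))
  have G: "card ?G > 0"
  proof -
    have "id \<in> ?G" by (simp add: auts_def permutes_id)
    then show ?thesis by (metis card_gt_0_iff empty_iff finite_auts)
  qed
  have apex: "12 * int (card ?A) * int (cnt q) = int (card ?G) * extremal_count m" if "q \<in> ?A" for q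
  proof -
    have "int (cnt q) * int (card ?A) = int (card ?G) * int (card {q \<in> ?A. quad_sep ?f q})"
      unfolding cnt_def using card_auts_apex[OF that, of "quad_sep ?f"]
      by (simp flip: of_nat_mult)
    then show ?thesis unfolding card_apex_quads_sep_alt_pos[symmetric] by (simp add: algebra_simps)
  qed
  \<comment> \<open>After clearing denominators, the second inequality says that an apex pair is
    separated with probability at most \<open>(M + 1) / (3 * M)\<close>; it reduces to
    \<open>2 * M \<le> M * M\<close>.\<close>
  have ext: "0 < extremal_count m" "extremal_count m \<le> 8 * M * ((M - 1) * (M + 1))"
  proof -
    have sq: "2 * M \<le> M * M" using M by simp
    then have "2 * (M * M) \<le> M * M * M" using M by (simp add: mult.assoc)
    moreover have "extremal_count m \<ge> 8 * (M * M * M) - 3 * (M * M) - 2 * M - 3"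
      "extremal_count m \<le> 8 * (M * M * M) - 3 * (M * M) - 2 * M"
      by (auto simp: extremal_count_def M_def power2_eq_square power3_eq_cube)
    moreover have "8 * M * ((M - 1) * (M + 1)) = 8 * (M * M * M) - 8 * M"
      by (simp add: algebra_simps)
    ultimately show "0 < extremal_count m" "extremal_count m \<le> 8 * M * ((M - 1) * (M + 1))"
      using sq M by (smt (verit))+
  qed
  have base: "cnt q0 \<le> cnt q" if "q \<in> ?B" for q
  proof -
    have "int (cnt q) * int (card ?B) = int (card ?G) * int (card {q \<in> ?B. quad_sep ?f q})"
      unfolding cnt_def using card_auts_base[OF that, of "quad_sep ?f"]
      by (simp flip: of_nat_mult)
    then have "3 * (int (cnt q) * int (card ?B)) = int (card ?G) * (3 * int (card {q \<in> ?B. quad_sep ?f q}))"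
      by simp
    then have "(2 * (M * (M - 1)\<^sup>2)) * (3 * M * int (cnt q)) = (2 * (M * (M - 1)\<^sup>2)) * (int (card ?G) * (M + 1))"
      unfolding cB card_base_quads_sep_alt_pos M_def[symmetric]
      by (simp add: power2_eq_square algebra_simps)
    \<comment> \<open>So a pair avoiding the apex is separated with probability
      \<open>(M + 1) / (3 * M)\<close>.\<close>
    then have eq: "3 * M * int (cnt q) = int (card ?G) * (M + 1)"
      using M by (subst (asm) mult_cancel_left) auto
    have "(24 * (M * M * (M - 1))) * int (cnt q0) = int (card ?G) * extremal_count m"
      using apex[OF q0] unfolding cA by simp
    also have "\<dots> \<le> int (card ?G) * (8 * M * ((M - 1) * (M + 1)))"
      using ext(2) by (intro mult_left_mono) auto
    also have "\<dots> = 8 * M * (M - 1) * (int (card ?G) * (M + 1))" by (simp add: algebra_simps)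
    also have "\<dots> = (24 * (M * M * (M - 1))) * int (cnt q)"
      unfolding eq[symmetric] by (simp add: algebra_simps)
    finally have "(24 * (M * M * (M - 1))) * int (cnt q0) \<le> (24 * (M * M * (M - 1))) * int (cnt q)" .
    moreover have "24 * (M * M * (M - 1)) > 0" using M by simp
    ultimately show ?thesis by (metis mult_le_cancel_left_pos of_nat_le_iff)
  qed
  have all: "cnt q0 \<le> cnt q" if "q \<in> ?A \<union> ?B" for q
  proof (cases "q \<in> ?A")
    case True
    have "12 * int (card ?A) * int (cnt q) = 12 * int (card ?A) * int (cnt q0)"
      using apex[OF True] apex[OF q0] by simp
    then show ?thesis using q0 by auto
  qed (use base that in auto)
  obtain gs where gs: "set gs = ?G" "distinct gs" using finite_distinct_list[OF finite_auts] by blast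
  define rs where "rs = map (\<lambda>g. order_of (verts m) (?f \<circ> g)) gs"
  have len: "length rs = card ?G" using gs distinct_card[of gs] by (simp add: rs_def)
  have inj: "inj_on (?f \<circ> g) (verts m)" if "g \<in> ?G" for g
  proof (rule comp_inj_on)
    show "inj_on g (verts m)" using auts_bij[OF that] by (metis bij_is_inj inj_on_subset subset_UNIV)
    show "inj_on ?f (g ` verts m)"
      by (rule inj_on_subset[OF inj_on_alt_pos]) (auto simp: auts_image[OF that])
  qed
  have sep: "length (filter (\<lambda>r. separates r {a, b} {c, d}) rs) = cnt ((a, b), (c, d))"
    if "((a, b), (c, d)) \<in> ?A \<union> ?B" for a b c d
  proof -
    have "separates (order_of (verts m) (?f \<circ> g)) {a, b} {c, d} \<longleftrightarrow> quad_sep ?f (quad_map g ((a, b), (c, d)))"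
      if "g \<in> ?G" for g
      using separates_order_of[OF inj[OF that], of a b c d] quads_edges[of a b c d m]
        \<open>((a, b), (c, d)) \<in> ?A \<union> ?B\<close> by simp
    then have "{g \<in> ?G. separates (order_of (verts m) (?f \<circ> g)) {a, b} {c, d}} =
        {g \<in> ?G. quad_sep ?f (quad_map g ((a, b), (c, d)))}" by blast
    moreover have "length (filter (\<lambda>r. separates r {a, b} {c, d}) rs) =
      card (set (filter (\<lambda>g. separates (order_of (verts m) (?f \<circ> g)) {a, b} {c, d}) gs))"
      unfolding rs_def filter_map length_map using gs(2)
      by (subst distinct_card) (simp_all add: comp_def)
    ultimately show ?thesis by (simp add: gs(1) cnt_def)
  qed
  have "separating_list (verts m) (multipartite_edges [1, m, m]) (cnt q0) rs"
    unfolding separating_list_def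
  proof (intro conjI ballI impI)
    fix r assume "r \<in> set rs"
    then show "linear_order_on (verts m) r"
      using inj gs(1) by (auto simp: rs_def intro!: linear_order_on_order_of)
  next
    fix e f assume ef: "e \<in> multipartite_edges [1, m, m]" "f \<in> multipartite_edges [1, m, m]" "nonincident e f"
    show "cnt q0 \<le> length (filter (\<lambda>r. separates r e f) rs)"
      using ef
    proof (rule edges_quads)
      fix a b c d assume "((a, b), (c, d)) \<in> ?A \<union> ?B"
        "e = {a, b} \<and> f = {c, d} \<or> f = {a, b} \<and> e = {c, d}"
      then have q: "((a, b), (c, d)) \<in> ?A \<union> ?B"
        and "separates r e f \<longleftrightarrow> separates r {a, b} {c, d}" for r
        using separates_commute[of r e f] by auto
      then show ?thesis using sep[OF q] all[OF q] by simp
    qed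
  qed
  moreover have "0 < cnt q0"
  proof (rule ccontr)
    assume "\<not> 0 < cnt q0"
    then have "int (card ?G) * extremal_count m = 0" using apex[OF q0] by simp
    then show False using G ext(1) by simp
  qed
  ultimately show ?thesis using apex[OF q0] len by metis
qed

theorem mainTheorem13:
  fixes m :: nat
  assumes "m \<ge> 2"
  shows "frac_sep_dim (multipartite_verts [1, m, m]) (multipartite_edges [1, m, m]) =
    ereal (24 * real m / (8 * real m + 5 + 3 / (2 * real_of_int \<lceil>real m / 2\<rceil> - 1)))"
proof -
  define K where "K = real_of_int (extremal_count m)"
  \<comment> \<open>The reciprocal of the largest fraction of apex pairs that one ordering
    separates.\<close>
  define C where "C = 12 * real (card (apex_quads m)) / K"
  have cA: "real (card (apex_quads m)) = 2 * (real m * real m * (real m - 1))"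
    using assms by (simp add: card_apex_quads of_nat_diff)
  have m: "real m \<ge> 2" using assms by simp
  obtain T rs where T: "0 < T" "separating_list (verts m) (multipartite_edges [1, m, m]) T rs"
    "12 * int (card (apex_quads m)) * int T = int (length rs) * extremal_count m"
    using exists_optimal_separating_list[OF assms] by blast
  have T3: "12 * real (card (apex_quads m)) * real T = real (length rs) * K"
    using arg_cong[OF T(3), of real_of_int] by (simp add: K_def)
  have "12 * real (card (apex_quads m)) * real T > 0"
    using T(1) m unfolding cA by simp
  moreover have K0: "K \<noteq> 0" using T3 calculation by auto
  ultimately have K: "K > 0"
    unfolding T3 by (simp add: zero_less_mult_iff)
  have "frac_sep_dim (verts m) (multipartite_edges [1, m, m]) = ereal C"
  proof (rule frac_sep_dim_eqI[OF T(1,2)])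
    show "C * real T = real (length rs)" using T3 K by (simp add: C_def field_simps)
  next
    fix t rs assume "separating_list (verts m) (multipartite_edges [1, m, m]) t rs"
    then have "12 * int (card (apex_quads m)) * int t \<le> int (length rs) * extremal_count m"
      using assms by (intro separating_list_length_ge) auto
    then have "real_of_int (12 * int (card (apex_quads m)) * int t) \<le> real_of_int (int (length rs) * extremal_count m)"
      by (simp only: of_int_le_iff)
    then have "12 * real (card (apex_quads m)) * real t \<le> real (length rs) * K"
      by (simp add: K_def)
    then show "C * real t \<le> real (length rs)" using K by (simp add: C_def field_simps)
  qed
  moreover have "C = 24 * real m / (8 * real m + 5 + 3 / (2 * real_of_int \<lceil>real m / 2\<rceil> - 1))"
  proof -
    define D where "D = 8 * real m + 5 + 3 / (2 * real_of_int \<lceil>real m / 2\<rceil> - 1)"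
    \<comment> \<open>The denominator \<open>2 * \<lceil>m / 2\<rceil> - 1\<close> is
      \<open>m - 1\<close> for even \<open>m\<close> and \<open>m\<close> for odd \<open>m\<close>,
      so one factor of \<open>m * (m - 1)\<close> clears the fraction; this reproduces the parity
      term of \<open>extremal_count\<close>.\<close>
    have KD: "K = real m * (real m - 1) * D"
    proof (cases "even m")
      case True
      then have "real_of_int \<lceil>real m / 2\<rceil> = real m / 2" by (auto elim!: evenE)
      then have "D = 8 * real m + 5 + 3 / (real m - 1)" by (simp add: D_def)
      then have "(real m - 1) * D = (real m - 1) * (8 * real m + 5) + 3"
        using m by (simp add: field_simps)
      then have "real m * (real m - 1) * D = real m * ((real m - 1) * (8 * real m + 5) + 3)"
        by (metis mult.assoc)
      then show ?thesis
        using True by (simp add: K_def extremal_count_def algebra_simps power2_eq_square power3_eq_cube)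
    next
      case False
      then obtain k where k: "m = 2 * k + 1" by (elim oddE)
      then have "\<lceil>real m / 2\<rceil> = int k + 1" by (intro ceiling_unique) auto
      then have "D = 8 * real m + 5 + 3 / real m" using k by (simp add: D_def)
      then have "real m * D = real m * (8 * real m + 5) + 3"
        using m by (simp add: field_simps)
      then have "real m * (real m - 1) * D = (real m - 1) * (real m * (8 * real m + 5) + 3)"
        by (metis mult.assoc mult.commute)
      then show ?thesis
        using False by (simp add: K_def extremal_count_def algebra_simps power2_eq_square power3_eq_cube)
    qed
    then have "D \<noteq> 0" using K by auto
    then show ?thesis
      unfolding D_def[symmetric] C_def cA KD using m by (simp add: field_simps)
  qed
  ultimately show ?thesis by (simp only: verts_eq)
qed

end
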